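(* Let $f(z)=z+z^2+z^3+o(z^3)$ be a prenormalized parabolic germ of diffeomorphism of $(\mathbb{C},0)$ formally equivalent to $f_0(z)=\frac{z}{1-z}$. Let $g\in\mathbb{C}\{z\}$, $g\not\equiv0$, be of multiplicity $l\in\mathbb{N}_0$, i.e. $g(z)=\alpha_l z^l+o(z^l)$ with $\alpha_l\neq0$. The cohomological equation $$H(f(z))-H(z)=g(z)$$ has a (unique up to a constant) globally analytic solution on some neighborhood of $z=0$ if and only if $f$ is of the form $$f(z)=\begin{cases}\varphi^{-1}\Big(h_{\alpha_0,\alpha_1}^{-1}\big(h_{\alpha_0,\alpha_1}(\varphi(z))+g(z)\big)\Big), & l=0,1,\\[4pt] \varphi^{-1}\Big(\varphi(z)\cdot\big(1+\frac{l-1}{\alpha_l}\frac{g(z)}{\varphi(z)^{l-1}}\big)^{\frac1{l-1}}\Big), & l\in\mathbb{N},\ l\ge2,\end{cases}$$ for some analytic germ $\varphi(z)\in z+z^2\mathbb{C}\{z\}$. The globally analytic solution $H$ is then given (up to an additive constant) by $$H(z)=\begin{cases}h_{\alpha_0,\alpha_1}\circ\varphi(z), & l=0,1,\\[2pt] \frac{\alpha_l}{l-1}\varphi(z)^{l-1}, & l\in\mathbb{N},\ l\ge2.\end{cases}$$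
   Context: Formal changes of variables are tangent to the identity. Write $g(z)=\alpha_0+\alpha_1z+\alpha_2z^2+\cdots$. If $l=0$ ($\alpha_0\ne0$) or $l=1$ ($\alpha_0=0$, $\alpha_1\neq0$), put $h_{\alpha_0,\alpha_1}(z)=-\frac{\alpha_0}{z}+\alpha_1\log z$. When $\alpha_1\neq0$, the function $h_{\alpha_0,\alpha_1}$ has a logarithmic term; one then considers two branches of it on overlapping sectors, on which they are invertible, and the two resulting sectorial expressions for $f$ are glued into a germ analytic at $0$ and tangent to the identity by the theorem on removable singularities (similarly for $H$). In the case $l\ge2$ the $(l-1)$-th root is the branch taking the value $1$ at $1$. "Globally analytic solution" is meant as follows: $H$ is analytic on some neighborhood of $0$ after possibly subtracting the terms in $1/z$ and $\log z$, that is, $H(z)=-\frac{\alpha_0}{z}+\alpha_1\log z+R(z)$ where $R$ is analytic on a neighborhood of $0$ and satisfies there $$R(f(z))-R(z)=g(z)+\alpha_0\Big(\frac1{f(z)}-\frac1z\Big)-\alpha_1\log\Big(\frac{f(z)}{z}\Big)$$ (with $\log$ the principal branch, $f(z)/z\to1$). *)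

theory Defs
  imports "HOL-Complex_Analysis.Complex_Analysis" "HOL-Library.Landau_Symbols"
begin

text \<open>
  A germ at 0 is represented by a total function that is analytic at 0; equality of germs is
  equality eventually in \<^term>\<open>nhds 0\<close>.
\<close>

definition prenormalized_germ :: "(complex \<Rightarrow> complex) \<Rightarrow> bool" where
  "prenormalized_germ f \<longleftrightarrow>
     f analytic_on {0} \<and> f 0 = 0 \<and>
     (\<lambda>z. f z - (z + z ^ 2 + z ^ 3)) \<in> o[at 0](\<lambda>z. z ^ 3)"

definition formally_equivalent :: "(complex \<Rightarrow> complex) \<Rightarrow> (complex \<Rightarrow> complex) \<Rightarrow> bool" where
  "formally_equivalent f1 f2 \<longleftrightarrow>
     (\<exists>F1 F2 \<Phi>. f1 has_fps_expansion F1 \<and> f2 has_fps_expansion F2 \<and>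
        fps_nth \<Phi> 0 = 0 \<and> fps_nth \<Phi> 1 = 1 \<and> \<Phi> oo F1 = F2 oo \<Phi>)"

definition tangent_to_identity :: "(complex \<Rightarrow> complex) \<Rightarrow> bool" where
  "tangent_to_identity \<phi> \<longleftrightarrow> \<phi> analytic_on {0} \<and> \<phi> 0 = 0 \<and> deriv \<phi> 0 = 1"

definition germ_inverse :: "(complex \<Rightarrow> complex) \<Rightarrow> (complex \<Rightarrow> complex) \<Rightarrow> bool" where
  "germ_inverse \<phi> \<psi> \<longleftrightarrow>
     \<psi> analytic_on {0} \<and> \<psi> 0 = 0 \<and>
     (\<forall>\<^sub>F z in nhds 0. \<psi> (\<phi> z) = z \<and> \<phi> (\<psi> z) = z)"

text \<open>
  The sector with bisecting direction \<open>\<theta>\<close> and half-opening \<open>\<beta>\<close>. For \<open>pi / 2 < \<beta> < pi\<close> the sectors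
  in the directions 0 and \<open>pi\<close> overlap and cover a punctured disc, and the branch of the
  logarithm with argument in \<open>(\<theta> - pi, \<theta> + pi]\<close> is analytic on the sector in direction \<open>\<theta>\<close>.
\<close>

definition sector :: "real \<Rightarrow> real \<Rightarrow> real \<Rightarrow> complex set" where
  "sector \<theta> \<beta> r = {z. z \<noteq> 0 \<and> norm z < r \<and> \<bar>Arg (z * cis (- \<theta>))\<bar> < \<beta>}"

definition log_branch :: "real \<Rightarrow> complex \<Rightarrow> complex" where
  "log_branch \<theta> z = Ln (z * cis (- \<theta>)) + \<i> * of_real \<theta>"

definition h_branch :: "real \<Rightarrow> complex \<Rightarrow> complex \<Rightarrow> complex \<Rightarrow> complex" where
  "h_branch \<theta> a0 a1 z = - a0 / z + a1 * log_branch \<theta> z"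

text \<open>
  The sectorial form of \<open>f = \<phi>\<inverse> (h\<inverse> (h \<circ> \<phi> + g))\<close>, where \<open>\<psi>\<close> is the germ \<open>\<phi>\<inverse>\<close>: on a larger sector
  \<open>S\<close> the branch of \<open>h\<close> is injective, and \<open>h\<inverse>\<close> is its inverse on the image of \<open>S\<close>. The formula
  is also correct (with redundant sectors) if \<open>a1 = 0\<close> and \<open>h\<close> is single-valued.
\<close>

definition sectorial_form ::
  "real \<Rightarrow> complex \<Rightarrow> complex \<Rightarrow> (complex \<Rightarrow> complex) \<Rightarrow> (complex \<Rightarrow> complex) \<Rightarrow>
   (complex \<Rightarrow> complex) \<Rightarrow> (complex \<Rightarrow> complex) \<Rightarrow> bool" where
  "sectorial_form \<theta> a0 a1 f g \<phi> \<psi> \<longleftrightarrow>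
     (\<exists>\<beta> r \<beta>' r'. pi / 2 < \<beta> \<and> \<beta> < pi \<and> \<beta>' < pi \<and> 0 < r \<and> 0 < r' \<and>
        (let h = h_branch \<theta> a0 a1; S = sector \<theta> \<beta>' r' in
           inj_on h S \<and>
           (\<forall>z\<in>sector \<theta> \<beta> r. \<phi> z \<in> S \<and> h (\<phi> z) + g z \<in> h ` S \<and>
              f z = \<psi> (inv_into S h (h (\<phi> z) + g z)))))"

text \<open>
  Here \<open>\<alpha>\<close> is the sequence of Taylor coefficients of \<open>g\<close> and \<open>l\<close> its multiplicity. The base of
  the power tends to 1 at 0, so the principal branch is the one with value 1 at 1.
\<close>

definition has_normal_form ::
  "nat \<Rightarrow> (nat \<Rightarrow> complex) \<Rightarrow> (complex \<Rightarrow> complex) \<Rightarrow> (complex \<Rightarrow> complex) \<Rightarrow>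
   (complex \<Rightarrow> complex) \<Rightarrow> bool" where
  "has_normal_form l \<alpha> f g \<phi> \<longleftrightarrow>
     tangent_to_identity \<phi> \<and>
     (\<exists>\<psi>. germ_inverse \<phi> \<psi> \<and>
        (if l \<le> 1
         then \<forall>\<theta>\<in>{0, pi}. sectorial_form \<theta> (\<alpha> 0) (\<alpha> 1) f g \<phi> \<psi>
         else \<forall>\<^sub>F z in nhds 0.
           f z = \<psi> (\<phi> z * (1 + of_nat (l - 1) / \<alpha> l * (g z / \<phi> z ^ (l - 1)))
                            powr (1 / of_nat (l - 1)))))"

text \<open>
  The multivalued solution \<open>H z = - a0 / z + a1 log z + R z\<close> is represented by its analytic
  part \<open>R\<close>. Both sides of the equation for \<open>R\<close> extend analytically to 0, but the terms on the
  right-hand side have to be read at \<open>z \<noteq> 0\<close>.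
\<close>

definition globally_analytic_solution ::
  "complex \<Rightarrow> complex \<Rightarrow> (complex \<Rightarrow> complex) \<Rightarrow> (complex \<Rightarrow> complex) \<Rightarrow>
   (complex \<Rightarrow> complex) \<Rightarrow> bool" where
  "globally_analytic_solution a0 a1 f g R \<longleftrightarrow>
     R analytic_on {0} \<and>
     (\<forall>\<^sub>F z in at 0.
        R (f z) - R z = g z + a0 * (1 / f z - 1 / z) - a1 * Ln (f z / z))"

definition solution_branch ::
  "real \<Rightarrow> complex \<Rightarrow> complex \<Rightarrow> (complex \<Rightarrow> complex) \<Rightarrow> complex \<Rightarrow> complex" where
  "solution_branch \<theta> a0 a1 R z = - a0 / z + a1 * log_branch \<theta> z + R z"

text \<open>
  In the first case the constant \<open>c\<close> is the same on both sectors; in the second case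
  \<open>\<alpha> 0 = \<alpha> 1 = 0\<close>, so that \<open>H = R\<close>.
\<close>

definition solution_given_by ::
  "nat \<Rightarrow> (nat \<Rightarrow> complex) \<Rightarrow> (complex \<Rightarrow> complex) \<Rightarrow> (complex \<Rightarrow> complex) \<Rightarrow> bool" where
  "solution_given_by l \<alpha> \<phi> R \<longleftrightarrow>
     (\<exists>c. if l \<le> 1
          then \<forall>\<theta>\<in>{0, pi}. \<exists>\<beta> r. pi / 2 < \<beta> \<and> \<beta> < pi \<and> 0 < r \<and>
                 (\<forall>z\<in>sector \<theta> \<beta> r.
                    solution_branch \<theta> (\<alpha> 0) (\<alpha> 1) R z = h_branch \<theta> (\<alpha> 0) (\<alpha> 1) (\<phi> z) + c)
          else \<forall>\<^sub>F z in nhds 0. R z = \<alpha> l / of_nat (l - 1) * \<phi> z ^ (l - 1) + c)"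

end

theory Submission
  imports Defs
begin

text \<open>
  If \<open>H = h \<circ> \<phi>\<close> with \<open>h\<close> the model function (\<open>h_branch\<close> if \<open>l \<le> 1\<close>, a multiple of the power
  \<open>l - 1\<close> otherwise), then \<open>H \<circ> f - H = g\<close> means \<open>h (\<phi> (f z)) = h (\<phi> z) + g z\<close>, and inverting \<open>h\<close>
  gives the normal form of \<open>f\<close>. So everything rests on two points. First, every analytic \<open>R\<close> is, up
  to a constant, the single-valued part of some \<open>h \<circ> \<phi>\<close>; if \<open>l \<ge> 2\<close>, it is the orders of the two sides
  of the equation that force \<open>R - R 0\<close> to have order \<open>l - 1\<close> and the right leading coefficient, so that
  it has a root. Second, the solution is unique up to a constant: since \<open>f z - z\<close> has order 2,
  \<open>D \<circ> f - D\<close> has order exactly \<open>m + 1\<close> if \<open>D - D 0\<close> has order \<open>m > 0\<close>.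
\<close>

section \<open>Germs tangent to the identity\<close>

text \<open>The difference quotient has a removable singularity at 0. Being a total function, it
  gives the factorization at every \<open>z\<close>, so that later computations need no extra
  neighborhood for it.\<close>

lemma analytic_0_factor:
  fixes g :: "complex \<Rightarrow> complex"
  assumes "g analytic_on {0}"
  obtains u where "u analytic_on {0}" "u 0 = deriv g 0" "\<And>z. g z = g 0 + z * u z"
proof
  let ?u = "\<lambda>z. if z = 0 then deriv g 0 else (g z - g 0) / z"
  have d: "deriv (\<lambda>z. g z - g 0) 0 = deriv g 0"
    using assms analytic_on_imp_differentiable_at[of g "{0}" 0] by simp
  show "?u analytic_on {0}"
    by (rule pole_theorem_analytic_0[where g = "\<lambda>z. g z - g 0" and a = 0])
       (use assms d in \<open>auto intro!: analytic_intros exI[of _ 1]\<close>)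
qed auto

lemma analytic_0_factor_power:
  fixes A :: "complex \<Rightarrow> complex"
  assumes A: "A analytic_on {0}" "A 0 = 0" and nz: "\<not> (\<forall>\<^sub>F z in nhds 0. A z = 0)"
  obtains m E where "0 < m" "E analytic_on {0}" "E 0 \<noteq> 0" "\<forall>\<^sub>F z in nhds 0. A z = z ^ m * E z"
proof -
  obtain e where e: "0 < e" "A holomorphic_on ball 0 e"
    using A(1) analytic_at_ball by blast
  have "\<not> A constant_on ball 0 e"
  proof
    assume "A constant_on ball 0 e"
    then have "\<forall>z\<in>ball 0 e. A z = 0"
      using e(1) A(2) by (metis centre_in_ball constant_on_def)
    then have "\<forall>\<^sub>F z in nhds 0. A z = 0"
      using e(1) eventually_nhds_ball[of e "0::complex"] by (auto elim!: eventually_mono)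
    with nz show False by blast
  qed
  then obtain E r m where E: "0 < m" "0 < r" "E holomorphic_on ball 0 r"
      "\<And>w. w \<in> ball 0 r \<Longrightarrow> A w = (w - 0) ^ m * E w" "\<And>w. w \<in> ball 0 r \<Longrightarrow> E w \<noteq> 0"
    using holomorphic_factor_zero_nonconstant[OF e(2), of 0] e(1) A(2) by (metis centre_in_ball connected_ball open_ball)
  show thesis
  proof
    show "E analytic_on {0}" using E(2,3) analytic_at_ball by blast
    show "E 0 \<noteq> 0" using E(2,5) by simp
    show "\<forall>\<^sub>F z in nhds 0. A z = z ^ m * E z"
      using eventually_nhds_ball[OF E(2), of 0] E(4) by (auto elim!: eventually_mono)
  qed (fact E(1))
qed

lemma analytic_0_tendsto:
  fixes u :: "complex \<Rightarrow> complex"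
  assumes "u analytic_on {0}"
  shows "(u \<longlongrightarrow> u 0) (at 0)"
  using analytic_at_imp_isCont[OF assms] by (simp add: isCont_def)

lemma tangent_quotient:
  assumes "tangent_to_identity \<phi>"
  shows "((\<lambda>z. \<phi> z / z) \<longlongrightarrow> 1) (at 0)"
proof -
  have "(\<phi> has_field_derivative deriv \<phi> 0) (at 0)"
    using assms analytic_on_imp_differentiable_at[of \<phi> "{0}" 0] DERIV_deriv_iff_field_differentiable
    unfolding tangent_to_identity_def by blast
  then show ?thesis
    using assms by (simp add: tangent_to_identity_def has_field_derivative_iff)
qed

lemma tangent_nonzero:
  assumes "tangent_to_identity \<phi>"
  shows "\<forall>\<^sub>F z in at 0. \<phi> z \<noteq> 0"
  using tendsto_imp_eventually_ne[OF tangent_quotient[OF assms], of 0] by (auto elim!: eventually_mono)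

lemma tangent_filterlim:
  assumes "tangent_to_identity \<phi>"
  shows "filterlim \<phi> (at 0) (at 0)"
  using analytic_0_tendsto[of \<phi>] assms tangent_nonzero[OF assms]
  by (auto simp: filterlim_at tangent_to_identity_def)

text \<open>Makes the principal logarithm of \<open>\<phi> (f z) / \<phi> z\<close> small near 0.
  This selects the right branch of the logarithm if \<open>l \<le> 1\<close> and of the root if
  \<open>l \<ge> 2\<close>.\<close>

lemma tangent_comp_quotient:
  assumes \<phi>: "tangent_to_identity \<phi>" and f: "tangent_to_identity f"
  shows "((\<lambda>z. \<phi> (f z) / \<phi> z) \<longlongrightarrow> 1) (at 0)"
proof -
  have "((\<lambda>z. \<phi> (f z) / f z * (f z / z) / (\<phi> z / z)) \<longlongrightarrow> 1 * 1 / 1) (at 0)"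
    by (intro tendsto_intros tangent_quotient assms
          filterlim_compose[OF tangent_quotient[OF \<phi>] tangent_filterlim[OF f]]) auto
  moreover have "\<forall>\<^sub>F z in at 0. \<phi> (f z) / f z * (f z / z) / (\<phi> z / z) = \<phi> (f z) / \<phi> z"
    using tangent_nonzero[OF f] eventually_neq_at_within[of 0 0 UNIV]
    by eventually_elim (auto simp: field_simps)
  ultimately have "((\<lambda>z. \<phi> (f z) / \<phi> z) \<longlongrightarrow> 1 * 1 / 1) (at 0)"
    by (rule Lim_transform_eventually)
  then show ?thesis by simp
qed

lemma tangent_germ_inverse:
  assumes "tangent_to_identity \<phi>"
  obtains \<psi> where "germ_inverse \<phi> \<psi>"
proof -
  obtain e where e: "0 < e" "\<phi> holomorphic_on ball 0 e"
    using assms analytic_at_ball unfolding tangent_to_identity_def by blast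
  have "0 \<in> ball (0::complex) e" "deriv \<phi> 0 \<noteq> 0"
    using e(1) assms by (auto simp: tangent_to_identity_def)
  then obtain r where r: "0 < r" "ball 0 r \<subseteq> ball (0::complex) e" "open (\<phi> ` ball 0 r)" "inj_on \<phi> (ball 0 r)"
    by (rule has_complex_derivative_locally_invertible[OF e(2) _ open_ball])
  obtain \<psi> where \<psi>: "\<psi> holomorphic_on (\<phi> ` ball 0 r)" "\<And>z. z \<in> ball 0 r \<Longrightarrow> \<psi> (\<phi> z) = z"
    by (rule holomorphic_has_inverse[OF holomorphic_on_subset[OF e(2) r(2)] open_ball r(4)]) (rule that)
  have 0: "0 \<in> \<phi> ` ball 0 r"
    using r(1) assms by (force simp: tangent_to_identity_def)
  have "germ_inverse \<phi> \<psi>"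
    unfolding germ_inverse_def
  proof (intro conjI)
    show "\<psi> analytic_on {0}" using \<psi>(1) r(3) 0 analytic_at by blast
    show "\<psi> 0 = 0" using \<psi>(2)[of 0] r(1) assms by (simp add: tangent_to_identity_def)
    show "\<forall>\<^sub>F z in nhds 0. \<psi> (\<phi> z) = z \<and> \<phi> (\<psi> z) = z"
      using eventually_nhds_ball[OF r(1), of 0] eventually_nhds_in_open[OF r(3) 0]
      by eventually_elim (auto simp: \<psi>(2))
  qed
  then show thesis by (rule that)
qed

text \<open>As the remainder is \<open>o(z ^ 3)\<close>, the quotient of \<open>f z - z\<close> by
  \<open>z ^ 2\<close> is \<open>1 + z\<close> plus a null term; one more factor \<open>z\<close>
  then gives the derivative 1 at 0. The limit of the quotient says that \<open>f z - z\<close> has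
  order exactly 2, on which all comparisons of orders rest.\<close>

lemma prenormalized_germ_tangent:
  assumes "prenormalized_germ f"
  shows "tangent_to_identity f" and "((\<lambda>z. (f z - z) / z ^ 2) \<longlongrightarrow> 1) (at 0)"
proof -
  have an: "f analytic_on {0}" "f 0 = 0"
    and o: "(\<lambda>z. f z - (z + z ^ 2 + z ^ 3)) \<in> o[at 0](\<lambda>z. z ^ 3)"
    using assms by (auto simp: prenormalized_germ_def)
  have "((\<lambda>z. (f z - (z + z ^ 2 + z ^ 3)) / z ^ 3 * z + 1 + z) \<longlongrightarrow> 0 * 0 + 1 + 0) (at 0)"
    by (intro tendsto_intros smalloD_tendsto[OF o])
  moreover have "\<forall>\<^sub>F z in at 0. (f z - (z + z ^ 2 + z ^ 3)) / z ^ 3 * z + 1 + z = (f z - z) / z ^ 2"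
    using eventually_neq_at_within[of 0 0 UNIV]
    by eventually_elim (simp add: field_simps power2_eq_square power3_eq_cube)
  ultimately have "((\<lambda>z. (f z - z) / z ^ 2) \<longlongrightarrow> 0 * 0 + 1 + 0) (at 0)"
    by (rule Lim_transform_eventually)
  then show lim: "((\<lambda>z. (f z - z) / z ^ 2) \<longlongrightarrow> 1) (at 0)" by simp
  have "((\<lambda>z. 1 + (f z - z) / z ^ 2 * z) \<longlongrightarrow> 1 + 1 * 0) (at 0)"
    by (intro tendsto_intros lim)
  moreover have "\<forall>\<^sub>F z in at 0. 1 + (f z - z) / z ^ 2 * z = (f z - f 0) / (z - 0)"
    using eventually_neq_at_within[of 0 0 UNIV]
    by eventually_elim (simp add: field_simps power2_eq_square an)
  ultimately have "((\<lambda>z. (f z - f 0) / (z - 0)) \<longlongrightarrow> 1 + 1 * 0) (at 0)"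
    by (rule Lim_transform_eventually)
  then have "(f has_field_derivative 1) (at 0)"
    by (simp add: has_field_derivative_iff)
  then show "tangent_to_identity f"
    using an DERIV_imp_deriv by (auto simp: tangent_to_identity_def)
qed

section \<open>Orders of vanishing, and rigidity of invariant germs\<close>

lemma tendsto_divide_lower_power:
  fixes g :: "complex \<Rightarrow> complex"
  assumes g: "((\<lambda>z. g z / z ^ j) \<longlongrightarrow> a) (at 0)" and ij: "i < j"
  shows "((\<lambda>z. g z / z ^ i) \<longlongrightarrow> 0) (at 0)"
proof -
  have "((\<lambda>z. g z / z ^ j * z ^ (j - i)) \<longlongrightarrow> a * 0 ^ (j - i)) (at 0)"
    by (intro tendsto_intros g)
  moreover have "\<forall>\<^sub>F z in at 0. g z / z ^ j * z ^ (j - i) = g z / z ^ i"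
    using eventually_neq_at_within[of 0 0 UNIV]
  proof eventually_elim
    case (elim z)
    have "z ^ j = z ^ i * z ^ (j - i)" using ij by (simp flip: power_add)
    then show ?case using elim by simp
  qed
  ultimately have "((\<lambda>z. g z / z ^ i) \<longlongrightarrow> a * 0 ^ (j - i)) (at 0)"
    by (rule Lim_transform_eventually)
  moreover have "a * 0 ^ (j - i) = 0" using ij by simp
  ultimately show ?thesis by simp
qed

text \<open>With \<open>q = f z / z\<close> the difference is
  \<open>z ^ m * ((q ^ m - 1) * E (f z) + (E (f z) - E z))\<close>. Since \<open>f z - z\<close> has
  order 2 with coefficient 1, \<open>q - 1\<close> behaves like \<open>z\<close> and
  \<open>q ^ m - 1\<close> like \<open>m * z\<close>, whereas \<open>E (f z) - E z\<close> is
  \<open>o(z)\<close>.\<close>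

lemma power_difference_quotient:
  assumes f: "tangent_to_identity f" and f2: "((\<lambda>z. (f z - z) / z ^ 2) \<longlongrightarrow> 1) (at 0)"
    and E: "E analytic_on {0}" and A: "\<forall>\<^sub>F z in nhds 0. A z = z ^ m * E z"
  shows "((\<lambda>z. (A (f z) - A z) / z ^ Suc m) \<longlongrightarrow> of_nat m * E 0) (at 0)"
proof -
  obtain u where u: "u analytic_on {0}" "\<And>z. E z = E 0 + z * u z"
    using analytic_0_factor[OF E] by metis
  let ?q = "\<lambda>z. f z / z"
  have q: "(?q \<longlongrightarrow> 1) (at 0)" by (rule tangent_quotient[OF f])
  have ff: "filterlim f (at 0) (at 0)" by (rule tangent_filterlim[OF f])
  have uf: "((\<lambda>z. u (f z)) \<longlongrightarrow> u 0) (at 0)" and Ef: "((\<lambda>z. E (f z)) \<longlongrightarrow> E 0) (at 0)"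
    by (rule filterlim_compose[OF analytic_0_tendsto ff], fact)+
  \<comment> \<open>The summands are \<open>(q ^ m - 1) / z * E (f z)\<close>, written with a
    geometric sum, and \<open>(E (f z) - E z) / z\<close>, written with the difference quotient
    \<open>u\<close> of \<open>E\<close>. Only the first survives in the limit.\<close>
  have "((\<lambda>z. (f z - z) / z ^ 2 * (\<Sum>i<m. ?q z ^ i) * E (f z) + (?q z * u (f z) - u z))
          \<longlongrightarrow> 1 * (\<Sum>i<m. 1 ^ i) * E 0 + (1 * u 0 - u 0)) (at 0)"
    by (intro tendsto_intros f2 q uf Ef analytic_0_tendsto u)
  moreover have "\<forall>\<^sub>F z in at 0. (f z - z) / z ^ 2 * (\<Sum>i<m. ?q z ^ i) * E (f z) + (?q z * u (f z) - u z)
                     = (A (f z) - A z) / z ^ Suc m"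
    using eventually_neq_at_within[of 0 0 UNIV] filter_leD[OF at_within_le_nhds A]
      eventually_compose_filterlim[OF filter_leD[OF at_within_le_nhds A] ff]
  proof eventually_elim
    case (elim z)
    have fz: "f z = ?q z * z" using elim by simp
    have "(f z - z) / z ^ 2 * (\<Sum>i<m. ?q z ^ i) = ((?q z - 1) * (\<Sum>i<m. ?q z ^ i)) / z"
      using elim(1) by (simp add: field_simps power2_eq_square)
    also have "\<dots> = (?q z ^ m - 1) / z"
      by (simp only: power_diff_1_eq)
    finally have 1: "(f z - z) / z ^ 2 * (\<Sum>i<m. ?q z ^ i) = (?q z ^ m - 1) / z" .
    have 2: "?q z * u (f z) - u z = (E (f z) - E z) / z"
      using elim(1) u(2)[of z] u(2)[of "f z"] by (simp add: field_simps)
    have 3: "A (f z) = ?q z ^ m * z ^ m * E (f z)"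
      unfolding elim(3) using elim(1) by (simp add: power_divide)
    show ?case unfolding 1 2 elim(2) 3 using elim(1) by (simp add: divide_simps) (simp add: algebra_simps)
  qed
  ultimately have "((\<lambda>z. (A (f z) - A z) / z ^ Suc m) \<longlongrightarrow>
      1 * (\<Sum>i<m. 1 ^ i) * E 0 + (1 * u 0 - u 0)) (at 0)"
    by (rule Lim_transform_eventually)
  then show ?thesis by simp
qed

text \<open>Otherwise \<open>D - D 0\<close> has an order \<open>m > 0\<close> and a leading
  coefficient \<open>E 0\<close>, and \<open>D \<circ> f - D\<close>, which vanishes, would have the
  coefficient \<open>m * E 0 \<noteq> 0\<close> at order \<open>m + 1\<close>.\<close>

lemma invariant_imp_const:
  assumes f: "tangent_to_identity f" and f2: "((\<lambda>z. (f z - z) / z ^ 2) \<longlongrightarrow> 1) (at 0)"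
    and D: "D analytic_on {0}" and inv: "\<forall>\<^sub>F z in at 0. D (f z) = D z"
  shows "\<forall>\<^sub>F z in nhds 0. D z = D 0"
proof (rule ccontr)
  assume *: "\<not> ?thesis"
  have "(\<lambda>z. D z - D 0) analytic_on {0}" "D 0 - D 0 = 0" "\<not> (\<forall>\<^sub>F z in nhds 0. D z - D 0 = 0)"
    using D * by (auto intro!: analytic_intros)
  then obtain m E where E: "0 < m" "E analytic_on {0}" "E 0 \<noteq> 0" "\<forall>\<^sub>F z in nhds 0. D z - D 0 = z ^ m * E z"
    by (rule analytic_0_factor_power)
  have "((\<lambda>z. (D (f z) - D 0 - (D z - D 0)) / z ^ Suc m) \<longlongrightarrow> of_nat m * E 0) (at 0)"
    by (rule power_difference_quotient[OF f f2 E(2,4)])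
  moreover have "\<forall>\<^sub>F z in at 0. (D (f z) - D 0 - (D z - D 0)) / z ^ Suc m = 0"
    using inv by eventually_elim simp
  ultimately have "((\<lambda>z::complex. 0) \<longlongrightarrow> of_nat m * E 0) (at 0)"
    by (rule Lim_transform_eventually)
  then have "of_nat m * E 0 = 0"
    by (simp add: tendsto_const_iff)
  with E show False by simp
qed

section \<open>The model function on sectors\<close>

lemma Ln_quotient_tendsto_0:
  fixes q :: "complex \<Rightarrow> complex"
  assumes "(q \<longlongrightarrow> 1) (at 0)"
  shows "((\<lambda>z. Ln (q z)) \<longlongrightarrow> 0) (at 0)"
  using tendsto_Ln[OF assms] by simp

lemma Ln_quotient_small:
  fixes q :: "complex \<Rightarrow> complex"
  assumes "(q \<longlongrightarrow> 1) (at 0)" "0 < \<epsilon>"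
  shows "\<forall>\<^sub>F z in at 0. q z \<noteq> 0 \<and> \<bar>Im (Ln (q z))\<bar> < \<epsilon>"
proof -
  have "\<forall>\<^sub>F z in at 0. q z \<noteq> 0"
    by (rule tendsto_imp_eventually_ne[OF assms(1)]) simp
  moreover have "\<forall>\<^sub>F z in at 0. norm (Ln (q z)) < \<epsilon>"
    using Ln_quotient_tendsto_0[OF assms(1)] assms(2) by (auto simp: tendsto_iff)
  ultimately show ?thesis
    by eventually_elim (use abs_Im_le_cmod le_less_trans in blast)
qed

lemma Arg_Ln: "z \<noteq> 0 \<Longrightarrow> Im (Ln z) = Arg z"
  by (simp add: Arg_eq_Im_Ln)

text \<open>The rotation by \<open>Im (Ln q)\<close> fits into the gap \<open>pi - \<beta>\<close>
  between the sector and the branch cut, so no multiple of \<open>2 * pi * \<i>\<close>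
  appears.\<close>

lemma log_branch_mult:
  assumes "p \<noteq> 0" "q \<noteq> 0" "\<bar>Arg (p * cis (- \<theta>))\<bar> < \<beta>" "\<bar>Im (Ln q)\<bar> \<le> pi - \<beta>"
  shows "log_branch \<theta> (p * q) = log_branch \<theta> p + Ln q"
    and "Arg (p * q * cis (- \<theta>)) = Arg (p * cis (- \<theta>)) + Im (Ln q)"
proof -
  have "Ln (p * cis (- \<theta>) * q) = Ln (p * cis (- \<theta>)) + Ln q"
    by (rule Ln_times_simple) (use assms in \<open>auto simp: Arg_Ln\<close>)
  moreover have "p * cis (- \<theta>) * q = p * q * cis (- \<theta>)" by simp
  ultimately have *: "Ln (p * q * cis (- \<theta>)) = Ln (p * cis (- \<theta>)) + Ln q" by simp
  then show "log_branch \<theta> (p * q) = log_branch \<theta> p + Ln q"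
    by (simp add: log_branch_def)
  show "Arg (p * q * cis (- \<theta>)) = Arg (p * cis (- \<theta>)) + Im (Ln q)"
    using arg_cong[OF *, of Im] assms by (simp add: Arg_Ln)
qed

text \<open>One of \<open>z\<close> and \<open>- z\<close> lies in the closed right half-plane,
  where the argument is at most \<open>pi / 2\<close>. This is what glues the statements on the two
  sectors; \<open>- 0\<close> keeps the shape of \<open>sector\<close> at direction 0.\<close>

lemma sector_cover:
  assumes "z \<noteq> 0" "pi / 2 < \<beta>" "pi / 2 < \<beta>'" 
  shows "\<bar>Arg (z * cis (- 0))\<bar> < \<beta> \<or> \<bar>Arg (z * cis (- pi))\<bar> < \<beta>'"
proof (cases "0 \<le> Re z")
  case True
  then have "\<bar>Arg z\<bar> \<le> pi / 2" using Arg_Re_nonneg by blast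
  with assms show ?thesis by simp
next
  case False
  then have "\<bar>Arg (- z)\<bar> \<le> pi / 2" using Arg_Re_nonneg[of "- z"] by simp
  moreover have "cis (- pi) = - 1" by (simp add: complex_eq_iff)
  ultimately show ?thesis using assms by simp
qed

lemma norm_log_branch_le:
  assumes "z \<noteq> 0"
  shows "norm (log_branch \<theta> z) \<le> \<bar>ln (norm z)\<bar> + pi + \<bar>\<theta>\<bar>"
proof -
  have "norm (Ln (z * cis (- \<theta>))) \<le> \<bar>Re (Ln (z * cis (- \<theta>)))\<bar> + \<bar>Im (Ln (z * cis (- \<theta>)))\<bar>"
    by (rule cmod_le)
  moreover have "Re (Ln (z * cis (- \<theta>))) = ln (norm z)"
    using assms by (simp add: norm_mult)
  moreover have "\<bar>Im (Ln (z * cis (- \<theta>)))\<bar> \<le> pi"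
    using assms mpi_less_Im_Ln[of "z * cis (- \<theta>)"] Im_Ln_le_pi[of "z * cis (- \<theta>)"] by auto
  moreover have "norm (log_branch \<theta> z) \<le> norm (Ln (z * cis (- \<theta>))) + \<bar>\<theta>\<bar>"
    unfolding log_branch_def by (rule order_trans[OF norm_triangle_ineq]) (simp add: norm_mult)
  ultimately show ?thesis by linarith
qed

lemma Re_log_branch: "z \<noteq> 0 \<Longrightarrow> Re (log_branch \<theta> z) = ln (norm z)"
  by (simp add: log_branch_def norm_mult)

lemma norm_tendsto_0_at_right: "filterlim (norm :: complex \<Rightarrow> real) (at_right 0) (at 0)"
  unfolding filterlim_at
  using tendsto_norm_zero[OF tendsto_ident_at] eventually_neq_at_within[of 0 0 UNIV]
  by (auto elim!: eventually_mono)

section \<open>Growth of the model function at 0\<close>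

text \<open>If \<open>a0 \<noteq> 0\<close>, the pole dominates because \<open>z * log z\<close>
  tends to 0. If \<open>a0 = 0\<close>, the real part of every branch of the logarithm is
  \<open>ln (norm z)\<close>. Neither argument sees the branch cut, so the limit is over a full
  punctured neighborhood.\<close>

lemma h_branch_at_infinity:
  assumes "a0 \<noteq> 0 \<or> a1 \<noteq> 0"
  shows "filterlim (h_branch \<theta> a0 a1) at_infinity (at 0)"
proof (cases "a0 = 0")
  case True
  then have a1: "a1 \<noteq> 0" using assms by simp
  have "filterlim (\<lambda>z::complex. - ln (norm z)) at_top (at 0)"
    by (intro filterlim_compose[OF _ norm_tendsto_0_at_right]) real_asymp
  then have "filterlim (\<lambda>z::complex. norm a1 * - ln (norm z)) at_top (at 0)"
    using a1 by (intro filterlim_tendsto_pos_mult_at_top[OF tendsto_const]) auto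
  then have "filterlim (\<lambda>z. norm (h_branch \<theta> a0 a1 z)) at_top (at 0)"
  proof (rule filterlim_at_top_mono)
    show "\<forall>\<^sub>F z in at 0. norm a1 * - ln (norm z) \<le> norm (h_branch \<theta> a0 a1 z)"
      using eventually_neq_at_within[of 0 0 UNIV]
    proof eventually_elim
      case (elim z)
      have "- ln (norm z) \<le> norm (log_branch \<theta> z)"
        using abs_Re_le_cmod[of "log_branch \<theta> z"] Re_log_branch[OF elim, of \<theta>] by linarith
      then have "norm a1 * - ln (norm z) \<le> norm a1 * norm (log_branch \<theta> z)"
        by (rule mult_left_mono) simp
      then show ?case using True by (simp add: h_branch_def norm_mult)
    qed
  qed
  then show ?thesis by (rule filterlim_norm_at_top_imp_at_infinity)
next
  case False
  have "((\<lambda>z. norm z * (\<bar>ln (norm z)\<bar> + pi + \<bar>\<theta>\<bar>)) \<longlongrightarrow> 0) (at (0::complex))"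
    by (intro filterlim_compose[OF _ norm_tendsto_0_at_right]) real_asymp
  then have "((\<lambda>z. z * log_branch \<theta> z) \<longlongrightarrow> 0) (at 0)"
  proof (rule Lim_null_comparison[rotated])
    show "\<forall>\<^sub>F z in at 0. norm (z * log_branch \<theta> z) \<le> norm z * (\<bar>ln (norm z)\<bar> + pi + \<bar>\<theta>\<bar>)"
      using eventually_neq_at_within[of 0 0 UNIV]
      by eventually_elim (auto simp: norm_mult intro!: mult_left_mono norm_log_branch_le)
  qed
  then have "((\<lambda>z. - a0 + a1 * (z * log_branch \<theta> z)) \<longlongrightarrow> - a0 + a1 * 0) (at 0)"
    by (intro tendsto_intros)
  then have "filterlim (\<lambda>z. (- a0 + a1 * (z * log_branch \<theta> z)) / z) at_infinity (at 0)"
    by (rule filterlim_divide_at_infinity) (use False in \<open>auto simp: filterlim_at intro: eventually_neq_at_within\<close>)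
  moreover have "\<forall>\<^sub>F z in at 0. (- a0 + a1 * (z * log_branch \<theta> z)) / z = h_branch \<theta> a0 a1 z"
    using eventually_neq_at_within[of 0 0 UNIV]
    by eventually_elim (simp add: h_branch_def field_simps)
  ultimately show ?thesis
    by (subst (asm) filterlim_cong[OF refl refl]) auto
qed

text \<open>Used in contrapositive form: a point of a bounded sector at which the model function is
  large has to be close to 0.\<close>

lemma h_branch_bounded:
  assumes "0 < \<delta>" "\<delta> \<le> norm z" "norm z \<le> r"
  shows "norm (h_branch \<theta> a0 a1 z) \<le> norm a0 / \<delta> + norm a1 * (\<bar>ln \<delta>\<bar> + \<bar>ln r\<bar> + pi + \<bar>\<theta>\<bar>)"
proof -
  have z: "z \<noteq> 0" using assms by auto
  have "ln \<delta> \<le> ln (norm z)" "ln (norm z) \<le> ln r"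
    using assms z by auto
  then have "norm (log_branch \<theta> z) \<le> \<bar>ln \<delta>\<bar> + \<bar>ln r\<bar> + pi + \<bar>\<theta>\<bar>"
    using norm_log_branch_le[OF z, of \<theta>] by linarith
  then have "norm (a1 * log_branch \<theta> z) \<le> norm a1 * (\<bar>ln \<delta>\<bar> + \<bar>ln r\<bar> + pi + \<bar>\<theta>\<bar>)"
    by (simp add: norm_mult mult_left_mono)
  moreover have "norm (- a0 / z) \<le> norm a0 / \<delta>"
    using assms z by (simp add: norm_divide frac_le)
  ultimately show ?thesis
    unfolding h_branch_def by (intro order_trans[OF norm_triangle_ineq]) linarith
qed

section \<open>Injectivity of the model function on a sector wider than a half-plane\<close>

text \<open>The half-angle stays in \<open>[0, pi / 3]\<close>, where the cosine is at least
  \<open>1 / 2\<close>. Hence \<open>sin (x / 2) \<ge> x / 4\<close> by the mean value theorem, and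
  \<open>sin x = 2 * sin (x / 2) * cos (x / 2)\<close> is at least
  \<open>sin (x / 2)\<close>.\<close>

lemma sin_ge_quarter:
  assumes "0 \<le> x" "x \<le> 2 * pi / 3"
  shows "x / 4 \<le> sin (x::real)"
proof -
  let ?t = "x / 2"
  have t: "0 \<le> ?t" "?t \<le> pi / 3" using assms by auto
  have cos: "1 / 2 \<le> cos s" if "0 \<le> s" "s \<le> pi / 3" for s
    using cos_monotone_0_pi_le[of s "pi / 3"] that pi_gt_zero by (simp add: cos_60)
  have "?t / 2 \<le> sin ?t"
  proof (cases "?t = 0")
    case False
    then obtain s where "0 < s" "s < ?t" "sin ?t - sin 0 = (?t - 0) * cos s"
      using MVT2[of 0 ?t sin cos] t by (auto intro: DERIV_sin)
    moreover from this have "?t * (1 / 2) \<le> ?t * cos s"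
      using t by (intro mult_left_mono cos) auto
    moreover have "?t * (1 / 2) = ?t / 2" by simp
    ultimately show ?thesis by (simp only: sin_zero diff_zero)
  qed auto
  also have "\<dots> \<le> 2 * sin ?t * cos ?t"
    using mult_left_mono[OF cos[OF t], of "sin ?t"] sin_ge_zero[of ?t] t pi_gt_zero by simp
  also have "\<dots> = sin x" using sin_double[of ?t] by simp
  finally show ?thesis by simp
qed

text \<open>The strip contains no zero of \<open>exp d - 1\<close> except 0. With
  \<open>d = x + \<i> * y\<close>, the real part is bounded by \<open>x \<le> exp x - 1\<close>. For
  the imaginary part, the squared norm is
  \<open>(exp x - 1)\<^sup>2 + exp x * (2 - 2 * cos y)\<close> and
  \<open>2 - 2 * cos y = (2 * sin (y / 2))\<^sup>2\<close>, which gives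
  \<open>\<bar>y\<bar> / 4\<close> as a lower bound of the norm. The constant is
  \<open>1 + 4\<close>.\<close>

lemma norm_exp_minus_1_ge:
  assumes "0 \<le> Re d" "\<bar>Im d\<bar> \<le> 4 * pi / 3"
  shows "norm d \<le> 5 * norm (exp d - 1)"
proof -
  let ?x = "Re d" and ?y = "Im d"
  have "?x \<le> exp ?x - 1" using exp_ge_add_one_self[of ?x] by linarith
  also have "\<dots> \<le> norm (exp d - 1)"
    using norm_triangle_ineq2[of "exp d" 1] by (simp add: norm_exp_eq_Re)
  finally have x: "\<bar>?x\<bar> \<le> norm (exp d - 1)" using assms by simp
  have "\<bar>?y\<bar> / 8 \<le> sin (\<bar>?y\<bar> / 2)"
    using sin_ge_quarter[of "\<bar>?y\<bar> / 2"] assms(2) by simp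
  then have "(\<bar>?y\<bar> / 4)\<^sup>2 \<le> (2 * sin (\<bar>?y\<bar> / 2))\<^sup>2"
    by (intro power_mono) auto
  also have "\<dots> = 2 - 2 * cos ?y"
    using cos_double_sin[of "\<bar>?y\<bar> / 2"] by (simp add: power_mult_distrib)
  also have "\<dots> \<le> exp ?x * (2 - 2 * cos ?y)"
    using mult_right_mono[of 1 "exp ?x" "2 - 2 * cos ?y"] assms(1) by simp
  also have "\<dots> \<le> (exp ?x - 1)\<^sup>2 + exp ?x * (2 - 2 * cos ?y)"
    by simp
  also have "\<dots> = (norm (exp d - 1))\<^sup>2"
  proof -
    have "(norm (exp d - 1))\<^sup>2 = (exp ?x * cos ?y - 1)\<^sup>2 + (exp ?x * sin ?y)\<^sup>2"
      by (simp add: cmod_power2 Re_exp Im_exp)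
    also have "\<dots> = (exp ?x)\<^sup>2 * ((cos ?y)\<^sup>2 + (sin ?y)\<^sup>2) - 2 * exp ?x * cos ?y + 1"
      by algebra
    finally show ?thesis
      by (simp only: sin_cos_squared_add2) (simp add: power2_eq_square algebra_simps)
  qed
  finally have "\<bar>?y\<bar> / 4 \<le> norm (exp d - 1)"
    by (rule power2_le_imp_le) simp
  with x cmod_le[of d] show ?thesis by linarith
qed

text \<open>By symmetry \<open>Re v \<le> Re w\<close>; factoring out \<open>exp v\<close>, the
  exponential of smaller modulus, reduces the claim to \<open>exp (w - v) - 1\<close> with a
  nonnegative real part.\<close>

lemma norm_exp_diff_ge:
  assumes "\<bar>Im v - Im w\<bar> \<le> 4 * pi / 3" "M \<le> Re v" "M \<le> Re w"
  shows "exp M * norm (v - w) \<le> 5 * norm (exp v - exp w)"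
  using assms
proof (induction "Re v" "Re w" arbitrary: v w rule: linorder_wlog)
  case sym
  then show ?case by (smt (verit) norm_minus_commute)
next
  case le
  have "exp M * norm (v - w) \<le> exp (Re v) * (5 * norm (exp (w - v) - 1))"
    using norm_exp_minus_1_ge[of "w - v"] le by (intro mult_mono) (auto simp: norm_minus_commute abs_minus_commute)
  also have "\<dots> = 5 * norm (exp v * (exp (w - v) - 1))"
    by (simp add: norm_mult norm_exp_eq_Re)
  also have "exp v * (exp (w - v) - 1) = exp w - exp v"
    by (simp add: exp_diff algebra_simps)
  finally show ?case by (simp add: norm_minus_commute)
qed

text \<open>In the coordinate \<open>L = Ln (z * cis (- \<theta>))\<close>, equal values at two
  points mean that \<open>a1\<close> times the difference of the \<open>L\<close> equals, up to a
  unimodular factor, \<open>a0\<close> times the difference of the \<open>exp (- L)\<close>. On a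
  sector of radius \<open>r\<close> the latter difference is at least \<open>1 / (5 * r)\<close>
  times the former, so for small \<open>r\<close> the pole term wins unless the points coincide. The
  half-opening \<open>2 * pi / 3\<close> keeps the imaginary parts within \<open>4 * pi / 3\<close>
  of each other.\<close>

lemma h_branch_inj_on_sector:
  assumes "a0 \<noteq> 0 \<or> a1 \<noteq> 0"
  obtains r where "0 < r" "inj_on (h_branch \<theta> a0 a1) (sector \<theta> (2 * pi / 3) r)"
proof -
  \<comment> \<open>Chosen so that \<open>5 * r * norm a1 < norm a0\<close>; the summand 1 makes the
    inequality strict and covers \<open>a1 = 0\<close>. For \<open>a0 = 0\<close> only the logarithm
    is left and any radius will do.\<close>
  define r where "r = (if a0 = 0 then 1 else norm a0 / (5 * norm a1 + 1))"
  have n1: "0 < 5 * norm a1 + 1" using norm_ge_zero[of a1] by linarith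
  then have r: "0 < r" by (simp add: r_def)
  have "inj_on (h_branch \<theta> a0 a1) (sector \<theta> (2 * pi / 3) r)"
  proof (rule inj_onI)
    fix z w assume z: "z \<in> sector \<theta> (2 * pi / 3) r" and w: "w \<in> sector \<theta> (2 * pi / 3) r"
      and eq: "h_branch \<theta> a0 a1 z = h_branch \<theta> a0 a1 w"
    let ?l = "\<lambda>z. Ln (z * cis (- \<theta>))"
    have l: "\<bar>Im (?l x)\<bar> < 2 * pi / 3" "- ln r \<le> Re (- ?l x)" "x = exp (?l x) * cis \<theta>"
        "1 / x = exp (- ?l x) * cis (- \<theta>)"
      if "x \<in> sector \<theta> (2 * pi / 3) r" for x
    proof -
      have x: "x \<noteq> 0" "norm x < r" "\<bar>Arg (x * cis (- \<theta>))\<bar> < 2 * pi / 3"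
        using that by (auto simp: sector_def)
      show "\<bar>Im (?l x)\<bar> < 2 * pi / 3" using x by (simp add: Arg_Ln)
      show "- ln r \<le> Re (- ?l x)" using x r by (simp add: norm_mult)
      have e: "exp (?l x) = x * cis (- \<theta>)" using x by simp
      have c: "cis (- \<theta>) * cis \<theta> = 1" by (simp add: cis_mult)
      show "x = exp (?l x) * cis \<theta>" unfolding e using c by simp
      show "1 / x = exp (- ?l x) * cis (- \<theta>)" unfolding exp_minus e using x by (simp add: field_simps)
    qed
    have "a1 * (?l z - ?l w) = a0 * (1 / z - 1 / w)"
      using eq by (simp add: h_branch_def log_branch_def algebra_simps)
    also have "\<dots> = a0 * (exp (- ?l z) - exp (- ?l w)) * cis (- \<theta>)"
      unfolding l(4)[OF z] l(4)[OF w] by (simp only: algebra_simps)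
    finally have n: "norm a1 * norm (?l z - ?l w) = norm a0 * norm (exp (- ?l z) - exp (- ?l w))"
      by (metis norm_mult norm_cis mult.right_neutral)
    \<comment> \<open>The bound \<open>M = - ln r\<close> comes from the norms being below
      \<open>r\<close>, and yields the factor \<open>1 / r\<close>.\<close>
    have "exp (- ln r) * norm (- ?l z - - ?l w) \<le> 5 * norm (exp (- ?l z) - exp (- ?l w))"
    proof (rule norm_exp_diff_ge)
      show "\<bar>Im (- ?l z) - Im (- ?l w)\<bar> \<le> 4 * pi / 3"
        using l(1)[OF z] l(1)[OF w] unfolding uminus_complex.sel by linarith
    qed (fact l(2)[OF z] l(2)[OF w])+
    then have "norm (?l z - ?l w) \<le> 5 * r * norm (exp (- ?l z) - exp (- ?l w))"
      using r by (simp add: exp_minus norm_minus_commute field_simps)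
    then have "norm a0 * norm (?l z - ?l w) \<le> norm a0 * (5 * r * norm (exp (- ?l z) - exp (- ?l w)))"
      by (rule mult_left_mono) simp
    also have "\<dots> = 5 * r * norm a1 * norm (?l z - ?l w)"
      using n by simp
    finally have le: "norm a0 * norm (?l z - ?l w) \<le> 5 * r * norm a1 * norm (?l z - ?l w)" .
    have "?l z = ?l w"
    proof (cases "a0 = 0")
      case True
      then show ?thesis using n assms by simp
    next
      case False
      have "5 * r * norm a1 < norm a0"
        using False n1 by (simp add: r_def field_simps)
      show ?thesis
      proof (rule ccontr)
        assume "?l z \<noteq> ?l w"
        then have "5 * r * norm a1 * norm (?l z - ?l w) < norm a0 * norm (?l z - ?l w)"
          using \<open>5 * r * norm a1 < norm a0\<close> by (intro mult_strict_right_mono) auto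
        with le show False by simp
      qed
    qed
    then show "z = w" using l(3)[OF z] l(3)[OF w] by simp
  qed
  with r show thesis by (rule that)
qed

section \<open>The single-valued part\<close>

text \<open>Banach's theorem gives the fixed point for each \<open>z\<close> separately, without
  regularity in \<open>z\<close>. The iterates that start from the zero function are holomorphic and
  converge uniformly with error at most \<open>B / 2 ^ n\<close>, so the limit is
  holomorphic.\<close>

lemma holomorphic_contraction_fixpoint:
  fixes T :: "complex \<Rightarrow> complex \<Rightarrow> complex"
  assumes B: "0 \<le> B"
    and hol: "\<And>y. y holomorphic_on ball 0 r \<Longrightarrow> y ` ball 0 r \<subseteq> cball 0 B \<Longrightarrow>
                (\<lambda>z. T z (y z)) holomorphic_on ball 0 r"
    and self: "\<And>z v. norm z < r \<Longrightarrow> norm v \<le> B \<Longrightarrow> norm (T z v) \<le> B"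
    and lip: "\<And>z v w. norm z < r \<Longrightarrow> norm v \<le> B \<Longrightarrow> norm w \<le> B \<Longrightarrow>
                norm (T z v - T z w) \<le> norm (v - w) / 2"
  obtains y where "y holomorphic_on ball 0 r" "\<And>z. norm z < r \<Longrightarrow> norm (y z) \<le> B \<and> T z (y z) = y z"
proof -
  have "\<exists>v. norm v \<le> B \<and> T z v = v" if "norm z < r" for z
  proof -
    have "\<exists>!v. v \<in> cball 0 B \<and> T z v = v"
      by (rule Banach_fix[where c = "1 / 2"])
         (use B self[OF that] lip[OF that] in \<open>auto simp: complete_eq_closed dist_norm\<close>)
    then show ?thesis by auto
  qed
  then obtain y where y: "\<And>z. norm z < r \<Longrightarrow> norm (y z) \<le> B \<and> T z (y z) = y z"
    by metis
  define Y where "Y n = ((\<lambda>w z. T z (w z)) ^^ n) (\<lambda>_. 0)" for n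
  have Y_Suc: "Y (Suc n) = (\<lambda>z. T z (Y n z))" for n by (simp add: Y_def)
  have Y: "Y n holomorphic_on ball 0 r \<and> Y n ` ball 0 r \<subseteq> cball 0 B \<and>
           (\<forall>z\<in>ball 0 r. norm (Y n z - y z) \<le> B * (1 / 2) ^ n)" for n
  proof (induction n)
    case 0
    show ?case using B y by (auto simp: Y_def)
  next
    case (Suc n)
    have "norm (T z (Y n z) - y z) \<le> B * (1 / 2) ^ Suc n" if "z \<in> ball 0 r" for z
    proof -
      have "Y n z \<in> cball 0 B" using that Suc by blast
      then have "norm (T z (Y n z) - T z (y z)) \<le> norm (Y n z - y z) / 2"
        using that y by (intro lip) auto
      also have "\<dots> \<le> B * (1 / 2) ^ n / 2"
        using Suc that by simp
      finally show ?thesis using y that by simp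
    qed
    then show ?case
      using hol[of "Y n"] Suc self by (auto simp: Y_Suc image_subset_iff)
  qed
  have "uniform_limit (ball 0 r) Y y sequentially"
  proof (rule uniform_limitI)
    fix e :: real assume "0 < e"
    have "(\<lambda>n. B * (1 / 2) ^ n) \<longlonglongrightarrow> B * 0"
      by (intro tendsto_intros LIMSEQ_realpow_zero) auto
    then have "\<forall>\<^sub>F n in sequentially. B * (1 / 2) ^ n < e"
      using \<open>0 < e\<close> by (intro order_tendstoD) auto
    then show "\<forall>\<^sub>F n in sequentially. \<forall>z\<in>ball 0 r. dist (Y n z) (y z) < e"
      by eventually_elim (use Y le_less_trans in \<open>unfold dist_norm, blast\<close>)
  qed
  then have lim: "uniform_limit S Y y sequentially" if "S \<subseteq> ball 0 r" for S
    using that by (rule uniform_limit_on_subset)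
  have "y holomorphic_on ball 0 r"
  proof (rule holomorphic_uniform_sequence[OF open_ball])
    show "Y n holomorphic_on ball 0 r" for n using Y by blast
    show "\<exists>d>0. cball x d \<subseteq> ball 0 r \<and> uniform_limit (cball x d) Y y sequentially"
      if "x \<in> ball 0 r" for x
      using that lim open_contains_cball[of "ball 0 r"] by (metis open_ball)
  qed
  then show thesis using y by (rule that)
qed

lemma Ln_1_plus_lipschitz:
  assumes "norm s \<le> 1 / 2" "norm t \<le> 1 / 2"
  shows "norm (Ln (1 + s) - Ln (1 + t)) \<le> 2 * norm (s - t)"
proof (rule field_differentiable_bound[OF convex_cball[of 0 "1 / 2"]])
  fix z :: complex assume "z \<in> cball 0 (1 / 2)"
  then have z: "norm z \<le> 1 / 2" by simp
  have "- Re z \<le> norm z" using abs_Re_le_cmod[of z] by linarith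
  then have "1 + z \<notin> \<real>\<^sub>\<le>\<^sub>0" using z by (auto simp: complex_nonpos_Reals_iff)
  then show "((\<lambda>z. Ln (1 + z)) has_field_derivative inverse (1 + z)) (at z within cball 0 (1 / 2))"
    by (auto intro!: derivative_eq_intros simp: field_simps)
  have "1 / 2 \<le> norm (1 + z)" using norm_triangle_ineq2[of 1 "- z"] z by simp
  then have "inverse (norm (1 + z)) \<le> inverse (1 / 2)"
    by (intro le_imp_inverse_le) auto
  then show "norm (inverse (1 + z)) \<le> 2"
    by (simp add: norm_inverse)
qed (use assms in auto)

section \<open>Single-valued parts of \<open>h \<circ> \<phi>\<close>\<close>

lemma tangent_mult:
  assumes "u analytic_on {0}" "u 0 = 1"
  shows "tangent_to_identity (\<lambda>z. z * u z)"
proof -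
  have "(u has_field_derivative deriv u 0) (at 0)"
    using assms(1) analytic_on_imp_differentiable_at[of u "{0}" 0] DERIV_deriv_iff_field_differentiable by blast
  then have "((\<lambda>z. z * u z) has_field_derivative 1) (at 0)"
    using assms(2) by (auto intro!: derivative_eq_intros)
  then show ?thesis
    using assms(1) by (auto simp: tangent_to_identity_def DERIV_imp_deriv intro!: analytic_intros)
qed

text \<open>
  The single-valued part \<open>R\<close> of \<open>h \<circ> \<phi> = - a0 / z + a1 log z + R z\<close>.
\<close>

definition analytic_part :: "complex \<Rightarrow> complex \<Rightarrow> (complex \<Rightarrow> complex) \<Rightarrow> complex \<Rightarrow> complex" where
  "analytic_part a0 a1 \<phi> z = a0 * (1 / z - 1 / \<phi> z) + a1 * Ln (\<phi> z / z)"

text \<open>With \<open>\<phi> z = z * u z\<close> and \<open>u z = 1 + z * v z\<close> the poles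
  cancel: \<open>1 / z - 1 / \<phi> z = v z / u z\<close>. The logarithm is \<open>Ln (u z)\<close>,
  analytic because \<open>u 0 = 1\<close>.\<close>

lemma analytic_part_extends:
  assumes "tangent_to_identity \<phi>"
  obtains R where "R analytic_on {0}" "\<forall>\<^sub>F z in at 0. R z = analytic_part a0 a1 \<phi> z"
proof -
  obtain u where u: "u analytic_on {0}" "u 0 = 1" "\<And>z. \<phi> z = z * u z"
    using assms analytic_0_factor[of \<phi>] unfolding tangent_to_identity_def by (metis add_0)
  obtain v where v: "v analytic_on {0}" "\<And>z. u z = 1 + z * v z"
    using u analytic_0_factor[of u] by metis
  show thesis
  proof
    show "(\<lambda>z. a0 * (v z / u z) + a1 * Ln (u z)) analytic_on {0}"
      using u v by (auto intro!: analytic_intros)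
    show "\<forall>\<^sub>F z in at 0. a0 * (v z / u z) + a1 * Ln (u z) = analytic_part a0 a1 \<phi> z"
      using eventually_neq_at_within[of 0 0 UNIV] tangent_nonzero[OF assms]
    proof eventually_elim
      case (elim z)
      then have "u z \<noteq> 0" using u(3) by auto
      then have "v z / u z = 1 / z - 1 / (z * u z)"
        using elim(1) v(2)[of z] by (simp add: divide_simps)
      then show ?case using elim(1) by (simp add: analytic_part_def u(3))
    qed
  qed
qed

text \<open>
  With \<open>\<phi> z = z / (1 + z * y z)\<close> the equation \<open>analytic_part a0 a1 \<phi> = R\<close> is the fixed point equation
  \<open>y = - (R + a1 * Ln (1 + z * y)) / a0\<close>, which is contracting for small \<open>z\<close>.
\<close>

lemma analytic_part_surj_aux:
  assumes R: "R analytic_on {0}" and a0: "a0 \<noteq> 0"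
  obtains y where "y analytic_on {0}"
    "\<forall>\<^sub>F z in nhds 0. norm (z * y z) < 1 \<and> - a0 * y z - a1 * Ln (1 + z * y z) = R z"
proof -
  obtain e where e: "0 < e" "R holomorphic_on ball 0 e"
    using R analytic_at_ball by blast
  have "\<forall>\<^sub>F z in nhds 0. norm (R z) < norm (R 0) + 1"
    using analytic_at_imp_isCont[OF R] unfolding isCont_def tendsto_at_iff_tendsto_nhds
    by (intro order_tendstoD(2)[of "\<lambda>z. norm (R z)" "norm (R 0)"] tendsto_norm) auto
  then obtain d where d: "0 < d" "\<And>z. norm z < d \<Longrightarrow> norm (R z) < norm (R 0) + 1"
    unfolding eventually_nhds_metric by auto
  \<comment> \<open>Bounds the right-hand side of the fixed point equation, as \<open>R\<close> has
    norm below \<open>norm (R 0) + 1\<close> near 0 and the logarithm has norm at most 1.\<close>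
  define B where "B = (norm (R 0) + 1 + norm a1) / norm a0"
  have B: "0 < B" using a0 unfolding B_def by (intro divide_pos_pos add_pos_nonneg add_nonneg_pos) auto
  \<comment> \<open>In turn: \<open>R\<close> is holomorphic, \<open>R\<close> is bounded as above,
    \<open>norm (z * y) \<le> 1 / 2\<close> keeps \<open>1 + z * y\<close> off the branch cut, and
    the Lipschitz constant \<open>2 * norm a1 * norm z / norm a0\<close> is at most
    \<open>1 / 2\<close>.\<close>
  define r where "r = Min {e, d, 1 / (2 * B), norm a0 / (4 * norm a1 + 1)}"
  have r: "0 < r" "r \<le> e" "r \<le> d" "r \<le> 1 / (2 * B)" "r \<le> norm a0 / (4 * norm a1 + 1)"
    using e(1) d(1) B a0 norm_ge_zero[of a1] by (auto simp: r_def add_nonneg_pos)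
  have small: "norm (z * v) \<le> 1 / 2" if "norm z < r" "norm v \<le> B" for z v :: complex
  proof -
    have "norm z * norm v \<le> 1 / (2 * B) * B"
      using that r B by (intro mult_mono) auto
    then show ?thesis using B by (simp add: norm_mult)
  qed
  have a1: "4 * norm a1 * norm z \<le> norm a0" if "norm z < r" for z :: complex
  proof -
    have "4 * norm a1 * norm z \<le> (4 * norm a1 + 1) * (norm a0 / (4 * norm a1 + 1))"
      using that r norm_ge_zero[of a1] by (intro mult_mono) auto
    also have "\<dots> = norm a0"
      using norm_ge_zero[of a1] by (subst times_divide_eq_right, subst nonzero_mult_div_cancel_left) linarith+
    finally show ?thesis .
  qed
  define T where "T z v = - (R z + a1 * Ln (1 + z * v)) / a0" for z v
  have "\<exists>y. y holomorphic_on ball 0 r \<and> (\<forall>z. norm z < r \<longrightarrow> norm (y z) \<le> B \<and> T z (y z) = y z)"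
  proof (rule holomorphic_contraction_fixpoint[of B r T])
    show "0 \<le> B" using B by simp
    show "(\<lambda>z. T z (y z)) holomorphic_on ball 0 r"
      if y: "y holomorphic_on ball 0 r" "y ` ball 0 r \<subseteq> cball 0 B" for y
    proof -
      have "1 + z * y z \<notin> \<real>\<^sub>\<le>\<^sub>0" if "z \<in> ball 0 r" for z
      proof -
        have "y z \<in> cball 0 B" using that y(2) by blast
        then have "norm (z * y z) \<le> 1 / 2" using small[of z "y z"] that by simp
        moreover have "- Re (z * y z) \<le> norm (z * y z)" using abs_Re_le_cmod[of "z * y z"] by linarith
        ultimately show ?thesis by (auto simp: complex_nonpos_Reals_iff)
      qed
      moreover have "R holomorphic_on ball 0 r"
        using e(2) r(2) by (auto intro: holomorphic_on_subset)
      ultimately show ?thesis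
        unfolding T_def using y(1) a0 by (auto intro!: holomorphic_intros)
    qed
    show "norm (T z v) \<le> B" if "norm z < r" "norm v \<le> B" for z v
    proof -
      have "norm (Ln (1 + z * v)) \<le> 1"
        using Ln_1_plus_lipschitz[of "z * v" 0] small[OF that] by simp
      then have "norm (a1 * Ln (1 + z * v)) \<le> norm a1"
        by (simp add: norm_mult mult_left_le)
      moreover have "norm (R z) \<le> norm (R 0) + 1"
        using d(2)[of z] that r by simp
      ultimately have "norm (R z + a1 * Ln (1 + z * v)) \<le> norm (R 0) + 1 + norm a1"
        using norm_triangle_ineq[of "R z" "a1 * Ln (1 + z * v)"] by linarith
      then show ?thesis
        unfolding T_def B_def by (simp add: norm_divide divide_right_mono norm_minus_cancel del: minus_add_distrib)
    qed
    show "norm (T z v - T z w) \<le> norm (v - w) / 2" if "norm z < r" "norm v \<le> B" "norm w \<le> B" for z v w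
    proof -
      have "T z v - T z w = - (a1 * (Ln (1 + z * v) - Ln (1 + z * w))) / a0"
        using a0 by (simp add: T_def field_simps)
      then have "norm (T z v - T z w) = norm a1 * norm (Ln (1 + z * v) - Ln (1 + z * w)) / norm a0"
        by (simp add: norm_divide norm_mult del: minus_mult_right)
      also have "\<dots> \<le> norm a1 * (2 * norm (z * v - z * w)) / norm a0"
        by (intro divide_right_mono mult_left_mono Ln_1_plus_lipschitz small that) auto
      also have "\<dots> = 4 * norm a1 * norm z * norm (v - w) / (2 * norm a0)"
        by (simp add: norm_mult flip: right_diff_distrib)
      also have "\<dots> \<le> norm a0 * norm (v - w) / (2 * norm a0)"
        by (intro divide_right_mono mult_right_mono a1 that) auto
      also have "\<dots> = norm (v - w) / 2"
        using a0 by simp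
      finally show ?thesis .
    qed
  qed blast
  then obtain y where y: "y holomorphic_on ball 0 r" "\<And>z. norm z < r \<Longrightarrow> norm (y z) \<le> B \<and> T z (y z) = y z"
    by blast
  show thesis
  proof
    show "y analytic_on {0}" using y(1) r(1) analytic_at_ball by blast
    show "\<forall>\<^sub>F z in nhds 0. norm (z * y z) < 1 \<and> - a0 * y z - a1 * Ln (1 + z * y z) = R z"
      using eventually_nhds_ball[OF r(1), of 0]
    proof eventually_elim
      case (elim z)
      then have "- (R z + a1 * Ln (1 + z * y z)) / a0 = y z" "norm (z * y z) \<le> 1 / 2"
        using y(2)[of z] small[of z "y z"] by (auto simp: T_def)
      moreover from this a0 have "- (a0 * y z) = R z + a1 * Ln (1 + z * y z)"
        by (metis minus_minus nonzero_eq_divide_eq mult.commute)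
      ultimately show ?case by simp
    qed
  qed
qed

text \<open>For \<open>a0 = 0\<close> the equation \<open>a1 * Ln (\<phi> z / z) = R z + c\<close>
  is solved by an exponential, and tangency to the identity forces \<open>c = - R 0\<close>. For
  \<open>a0 \<noteq> 0\<close> one can take \<open>c = 0\<close>: the value \<open>R 0\<close> is
  absorbed by \<open>y 0\<close>, that is, by the second-order coefficient of
  \<open>\<phi>\<close>.\<close>

lemma analytic_part_surj:
  assumes R: "R analytic_on {0}" and a: "a0 \<noteq> 0 \<or> a1 \<noteq> 0"
  obtains \<phi> c where "tangent_to_identity \<phi>" "\<forall>\<^sub>F z in at 0. R z + c = analytic_part a0 a1 \<phi> z"
proof (cases "a0 = 0")
  case True
  define u where "u z = exp ((R z - R 0) / a1)" for z
  have "((\<lambda>z. (R z - R 0) / a1) \<longlongrightarrow> (R 0 - R 0) / a1) (at 0)"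
    using True a by (intro tendsto_intros analytic_0_tendsto[OF R]) auto
  then have "((\<lambda>z. norm ((R z - R 0) / a1)) \<longlongrightarrow> 0) (at 0)"
    using tendsto_norm_zero by fastforce
  \<comment> \<open>Keeps the exponent in the principal strip, where \<open>Ln\<close> undoes
    \<open>exp\<close>.\<close>
  then have small: "\<forall>\<^sub>F z in at 0. norm ((R z - R 0) / a1) < pi"
    by (rule order_tendstoD(2)) simp
  show thesis
  proof (rule that)
    show "tangent_to_identity (\<lambda>z. z * u z)"
      using R True a by (intro tangent_mult) (auto simp: u_def intro!: analytic_intros)
    show "\<forall>\<^sub>F z in at 0. R z + (- R 0) = analytic_part a0 a1 (\<lambda>z. z * u z) z"
      using small eventually_neq_at_within[of 0 0 UNIV]
    proof eventually_elim
      case (elim z)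
      have "Ln (u z) = (R z - R 0) / a1"
        unfolding u_def using elim(1) abs_Im_le_cmod[of "(R z - R 0) / a1"] by (intro Ln_exp) auto
      then show ?case using True a elim by (simp add: analytic_part_def)
    qed
  qed
next
  case False
  obtain y where y: "y analytic_on {0}"
    "\<forall>\<^sub>F z in nhds 0. norm (z * y z) < 1 \<and> - a0 * y z - a1 * Ln (1 + z * y z) = R z"
    by (rule analytic_part_surj_aux[OF R False])
  define u where "u z = 1 / (1 + z * y z)" for z
  show thesis
  proof (rule that)
    show "tangent_to_identity (\<lambda>z. z * u z)"
      using y(1) by (intro tangent_mult) (auto simp: u_def intro!: analytic_intros)
    show "\<forall>\<^sub>F z in at 0. R z + 0 = analytic_part a0 a1 (\<lambda>z. z * u z) z"
      using filter_leD[OF at_within_le_nhds y(2)] eventually_neq_at_within[of 0 0 UNIV]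
    proof eventually_elim
      case (elim z)
      let ?p = "1 + z * y z"
      have "- Re (z * y z) < 1" using elim(1) abs_Re_le_cmod[of "z * y z"] by linarith
      then have p: "?p \<notin> \<real>\<^sub>\<le>\<^sub>0" "?p \<noteq> 0"
        by (auto simp: complex_nonpos_Reals_iff complex_eq_iff)
      have "Ln (u z) = - Ln ?p"
        using Ln_inverse[OF p(1)] by (simp add: u_def inverse_eq_divide)
      moreover have "1 / z - 1 / (z * u z) = - y z"
        using elim(2) p(2) by (simp add: u_def field_simps)
      ultimately show ?case using elim(1,2) by (simp add: analytic_part_def)
    qed
  qed
qed

section \<open>The sectorial normal form\<close>

text \<open>
  The equation \<open>h \<circ> \<phi> \<circ> f - h \<circ> \<phi> = g\<close>, written without the multivalued logarithm.
\<close>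

definition conjugates_to_translation ::
  "complex \<Rightarrow> complex \<Rightarrow> (complex \<Rightarrow> complex) \<Rightarrow> (complex \<Rightarrow> complex) \<Rightarrow> (complex \<Rightarrow> complex) \<Rightarrow> bool" where
  "conjugates_to_translation a0 a1 \<phi> f g \<longleftrightarrow>
     (\<forall>\<^sub>F z in at 0. a0 * (1 / \<phi> z - 1 / \<phi> (f z)) + a1 * Ln (\<phi> (f z) / \<phi> z) = g z)"

lemma Ln_mult_small:
  assumes "p \<noteq> 0" "q \<noteq> 0" "\<bar>Im (Ln p)\<bar> < 1" "\<bar>Im (Ln q)\<bar> < 1"
  shows "Ln (p * q) = Ln p + Ln q"
  using assms pi_gt3 by (intro Ln_times_simple) linarith+

text \<open>All four quotients in \<open>\<phi> (f z) / f z * (f z / z) = \<phi> (f z) / \<phi> z *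
  (\<phi> z / z)\<close> tend to 1, so their principal logarithms add up without a period. Then the
  terms in \<open>1 / z\<close>, \<open>1 / f z\<close> and \<open>Ln (f z / z)\<close> cancel, as
  does \<open>c\<close>, and the two equations agree pointwise near 0.\<close>

lemma solution_iff_conjugates:
  assumes f: "tangent_to_identity f" and \<phi>: "tangent_to_identity \<phi>" and R: "R analytic_on {0}"
    and P: "\<forall>\<^sub>F z in at 0. R z = analytic_part a0 a1 \<phi> z + c"
  shows "globally_analytic_solution a0 a1 f g R \<longleftrightarrow> conjugates_to_translation a0 a1 \<phi> f g"
proof -
  note ff = tangent_filterlim[OF f]
  have \<phi>f: "((\<lambda>z. \<phi> (f z) / f z) \<longlongrightarrow> 1) (at 0)"
    by (rule filterlim_compose[OF tangent_quotient[OF \<phi>] ff])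
  have "\<forall>\<^sub>F z in at 0. R (f z) - R z = g z + a0 * (1 / f z - 1 / z) - a1 * Ln (f z / z) \<longleftrightarrow>
          a0 * (1 / \<phi> z - 1 / \<phi> (f z)) + a1 * Ln (\<phi> (f z) / \<phi> z) = g z"
    using P eventually_compose_filterlim[OF P ff] eventually_neq_at_within[of 0 0 UNIV]
      Ln_quotient_small[OF \<phi>f zero_less_one] Ln_quotient_small[OF tangent_quotient[OF f] zero_less_one]
      Ln_quotient_small[OF tangent_quotient[OF \<phi>] zero_less_one]
      Ln_quotient_small[OF tangent_comp_quotient[OF \<phi> f] zero_less_one]
  proof eventually_elim
    case (elim z)
    have "Ln (\<phi> (f z) / f z) + Ln (f z / z) = Ln (\<phi> (f z) / f z * (f z / z))"
      using elim by (intro Ln_mult_small[symmetric]) auto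
    also have "\<phi> (f z) / f z * (f z / z) = \<phi> (f z) / \<phi> z * (\<phi> z / z)"
      using elim by (simp add: field_simps)
    also have "Ln \<dots> = Ln (\<phi> (f z) / \<phi> z) + Ln (\<phi> z / z)"
      using elim by (intro Ln_mult_small) auto
    finally have L: "Ln (\<phi> (f z) / f z) = Ln (\<phi> (f z) / \<phi> z) + Ln (\<phi> z / z) - Ln (f z / z)"
      by (simp add: algebra_simps)
    have "R (f z) - R z - (a0 * (1 / f z - 1 / z) - a1 * Ln (f z / z)) =
        a0 * (1 / \<phi> z - 1 / \<phi> (f z)) + a1 * Ln (\<phi> (f z) / \<phi> z)"
      unfolding elim(1,2) analytic_part_def L by (simp only: algebra_simps)
    moreover have "d = y + p - q \<longleftrightarrow> x = y" if "d - (p - q) = x" for d p q x y :: complex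
      using that by (auto simp: algebra_simps)
    ultimately show ?case by blast
  qed
  then show ?thesis
    unfolding globally_analytic_solution_def conjugates_to_translation_def
    using R by (simp add: eventually_subst)
qed

text \<open>Both \<open>\<phi> z\<close> and \<open>\<phi> (f z)\<close> lie in the larger sector,
  on which the model function is injective. Its inverse therefore sends
  \<open>h (\<phi> z) + g z = h (\<phi> (f z))\<close> to \<open>\<phi> (f z)\<close>, and
  \<open>\<psi>\<close> sends this to \<open>f z\<close>.\<close>

lemma conjugates_imp_sectorial_form:
  assumes a: "a0 \<noteq> 0 \<or> a1 \<noteq> 0" and f: "tangent_to_identity f" and \<phi>: "tangent_to_identity \<phi>"
    and \<psi>: "germ_inverse \<phi> \<psi>" and conj: "conjugates_to_translation a0 a1 \<phi> f g"
  shows "sectorial_form \<theta> a0 a1 f g \<phi> \<psi>"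
proof -
  note ff = tangent_filterlim[OF f]
  obtain r' where r': "0 < r'" "inj_on (h_branch \<theta> a0 a1) (sector \<theta> (2 * pi / 3) r')"
    by (rule h_branch_inj_on_sector[OF a])
  have small: "\<forall>\<^sub>F z in at 0. \<phi> z \<noteq> 0 \<and> norm (\<phi> z) < r'"
    using tangent_nonzero[OF \<phi>] order_tendstoD(2)[OF tendsto_norm_zero, of \<phi> "at 0" r']
      analytic_0_tendsto[of \<phi>] \<phi> r'(1)
    by (auto simp: tangent_to_identity_def eventually_conj_iff)
  \<comment> \<open>The angles in units of \<open>pi / 24\<close>: the small sector has half-opening
    14, the passages from \<open>z\<close> to \<open>\<phi> z\<close> and on to
    \<open>\<phi> (f z)\<close> turn by less than 1 each, and 16 is the half-opening
    \<open>2 * pi / 3\<close> of the large sector.\<close>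
  have pi24: "0 < pi / 24" by simp
  have "\<forall>\<^sub>F z in nhds 0. \<psi> (\<phi> z) = z"
    using \<psi> unfolding germ_inverse_def by (auto elim: eventually_mono)
  note inv = filter_leD[OF at_within_le_nhds this]
  have "\<forall>\<^sub>F z in at 0. (\<phi> z \<noteq> 0 \<and> norm (\<phi> z) < r') \<and> (\<phi> (f z) \<noteq> 0 \<and> norm (\<phi> (f z)) < r') \<and>
      \<bar>Im (Ln (\<phi> z / z))\<bar> < pi / 24 \<and> \<bar>Im (Ln (\<phi> (f z) / \<phi> z))\<bar> < pi / 24 \<and>
      a0 * (1 / \<phi> z - 1 / \<phi> (f z)) + a1 * Ln (\<phi> (f z) / \<phi> z) = g z \<and> \<psi> (\<phi> (f z)) = f z"
    using small eventually_compose_filterlim[OF small ff] eventually_compose_filterlim[OF inv ff]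
      conj[unfolded conjugates_to_translation_def]
      Ln_quotient_small[OF tangent_quotient[OF \<phi>] pi24]
      Ln_quotient_small[OF tangent_comp_quotient[OF \<phi> f] pi24]
    by eventually_elim auto
  then obtain r where r: "0 < r" and near: "\<And>z. z \<noteq> 0 \<Longrightarrow> norm z < r \<Longrightarrow>
      (\<phi> z \<noteq> 0 \<and> norm (\<phi> z) < r') \<and> (\<phi> (f z) \<noteq> 0 \<and> norm (\<phi> (f z)) < r') \<and>
      \<bar>Im (Ln (\<phi> z / z))\<bar> < pi / 24 \<and> \<bar>Im (Ln (\<phi> (f z) / \<phi> z))\<bar> < pi / 24 \<and>
      a0 * (1 / \<phi> z - 1 / \<phi> (f z)) + a1 * Ln (\<phi> (f z) / \<phi> z) = g z \<and> \<psi> (\<phi> (f z)) = f z"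
    unfolding eventually_at by (auto simp: dist_norm)
  let ?h = "h_branch \<theta> a0 a1" and ?S = "sector \<theta> (2 * pi / 3) r'"
  have "\<phi> z \<in> ?S \<and> ?h (\<phi> z) + g z \<in> ?h ` ?S \<and> f z = \<psi> (inv_into ?S ?h (?h (\<phi> z) + g z))"
    if z: "z \<in> sector \<theta> (7 * pi / 12) r" for z
  proof -
    have z: "z \<noteq> 0" "norm z < r" "\<bar>Arg (z * cis (- \<theta>))\<bar> < 7 * pi / 12"
      using z by (auto simp: sector_def)
    note n = near[OF z(1,2)]
    have "Arg (z * (\<phi> z / z) * cis (- \<theta>)) = Arg (z * cis (- \<theta>)) + Im (Ln (\<phi> z / z))"
      by (rule log_branch_mult(2)[OF _ _ z(3)]) (use z n in auto)
    then have "Arg (\<phi> z * cis (- \<theta>)) = Arg (z * cis (- \<theta>)) + Im (Ln (\<phi> z / z))"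
      using z(1) by simp
    moreover have "\<bar>Im (Ln (\<phi> z / z))\<bar> < pi / 24" using n by blast
    ultimately have A1: "\<bar>Arg (\<phi> z * cis (- \<theta>))\<bar> < 15 * pi / 24"
      using z(3) by linarith
    have "Arg (\<phi> z * (\<phi> (f z) / \<phi> z) * cis (- \<theta>)) = Arg (\<phi> z * cis (- \<theta>)) + Im (Ln (\<phi> (f z) / \<phi> z))"
      by (rule log_branch_mult(2)[OF _ _ A1]) (use z n in auto)
    then have "Arg (\<phi> (f z) * cis (- \<theta>)) = Arg (\<phi> z * cis (- \<theta>)) + Im (Ln (\<phi> (f z) / \<phi> z))"
      using n by simp
    moreover have "\<bar>Im (Ln (\<phi> (f z) / \<phi> z))\<bar> < pi / 24" using n by blast
    ultimately have A2: "\<bar>Arg (\<phi> (f z) * cis (- \<theta>))\<bar> < 16 * pi / 24"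
      using A1 by linarith
    have "log_branch \<theta> (\<phi> z * (\<phi> (f z) / \<phi> z)) = log_branch \<theta> (\<phi> z) + Ln (\<phi> (f z) / \<phi> z)"
      by (rule log_branch_mult(1)[OF _ _ A1]) (use z n in auto)
    then have L: "log_branch \<theta> (\<phi> (f z)) = log_branch \<theta> (\<phi> z) + Ln (\<phi> (f z) / \<phi> z)"
      using n by simp
    have S: "\<phi> z \<in> ?S" "\<phi> (f z) \<in> ?S"
      using n A1 A2 by (auto simp: sector_def)
    have "?h (\<phi> z) + g z = ?h (\<phi> (f z))"
    proof -
      have "g z = a0 * (1 / \<phi> z - 1 / \<phi> (f z)) + a1 * Ln (\<phi> (f z) / \<phi> z)" using n by simp
      then show ?thesis unfolding h_branch_def L by (simp add: algebra_simps)
    qed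
    then show ?thesis
      using S n inv_into_f_f[OF r'(2) S(2)] by auto
  qed
  then show ?thesis
    unfolding sectorial_form_def Let_def using r r'
    by (intro exI[of _ "7 * pi / 12"] exI[of _ r] exI[of _ "2 * pi / 3"] exI[of _ r']) auto
qed

text \<open>
  The point \<open>inv_into S h (h (\<phi> z) + g z)\<close> is a priori anywhere in \<open>S\<close>, outside of the domain of the
  germ \<open>\<psi>\<close>. It tends to 0 because \<open>h\<close> tends to infinity only at 0.
\<close>

lemma sectorial_form_imp_conjugates_on_sector:
  assumes a: "a0 \<noteq> 0 \<or> a1 \<noteq> 0" and f: "tangent_to_identity f" and \<phi>: "tangent_to_identity \<phi>"
    and g: "g analytic_on {0}" and \<psi>: "germ_inverse \<phi> \<psi>" and form: "sectorial_form \<theta> a0 a1 f g \<phi> \<psi>"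
  obtains \<beta> where "pi / 2 < \<beta>"
    "\<forall>\<^sub>F z in at 0. \<bar>Arg (z * cis (- \<theta>))\<bar> < \<beta> \<longrightarrow>
        a0 * (1 / \<phi> z - 1 / \<phi> (f z)) + a1 * Ln (\<phi> (f z) / \<phi> z) = g z"
proof -
  let ?h = "h_branch \<theta> a0 a1"
  obtain \<beta> r \<beta>' r' where \<beta>: "pi / 2 < \<beta>" "\<beta>' < pi" and r: "0 < r" "0 < r'"
    and inj: "inj_on ?h (sector \<theta> \<beta>' r')"
    and form: "\<And>z. z \<in> sector \<theta> \<beta> r \<Longrightarrow> \<phi> z \<in> sector \<theta> \<beta>' r' \<and> ?h (\<phi> z) + g z \<in> ?h ` sector \<theta> \<beta>' r' \<and>
                 f z = \<psi> (inv_into (sector \<theta> \<beta>' r') ?h (?h (\<phi> z) + g z))"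
    using form unfolding sectorial_form_def Let_def by blast
  let ?S = "sector \<theta> \<beta>' r'"
  have "\<forall>\<^sub>F w in nhds 0. \<phi> (\<psi> w) = w"
    using \<psi> unfolding germ_inverse_def by (auto elim: eventually_mono)
  then obtain \<delta> where \<delta>: "0 < \<delta>" "\<And>w. norm w < \<delta> \<Longrightarrow> \<phi> (\<psi> w) = w"
    unfolding eventually_nhds_metric by auto
  \<comment> \<open>Bounds \<open>?h\<close> at the points of the large sector of norm at least
    \<open>\<delta>\<close>. A preimage of a value of norm above \<open>B\<close> thus lies where
    \<open>\<phi> \<circ> \<psi>\<close> is the identity.\<close>
  define B where "B = norm a0 / \<delta> + norm a1 * (\<bar>ln \<delta>\<bar> + \<bar>ln r'\<bar> + pi + \<bar>\<theta>\<bar>)"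
  have "filterlim (\<lambda>z. ?h (\<phi> z)) at_infinity (at 0)"
    by (rule filterlim_compose[OF h_branch_at_infinity[OF a] tangent_filterlim[OF \<phi>]])
  then have "filterlim (\<lambda>z. ?h (\<phi> z) + g z) at_infinity (at 0)"
    by (rule tendsto_add_filterlim_at_infinity'[OF _ analytic_0_tendsto[OF g]])
  then have big: "\<forall>\<^sub>F z in at 0. B < norm (?h (\<phi> z) + g z)"
    by (intro filterlim_at_top_dense[THEN iffD1, rule_format] filterlim_at_infinity_imp_norm_at_top)
  have small: "\<forall>\<^sub>F z in at 0. norm z < r"
    using r(1) unfolding eventually_at by (intro exI[of _ r]) (auto simp: dist_norm)
  have \<beta>'': "0 < pi - \<beta>'" using \<beta> by simp
  have "\<forall>\<^sub>F z in at 0. \<bar>Arg (z * cis (- \<theta>))\<bar> < \<beta> \<longrightarrow>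
        a0 * (1 / \<phi> z - 1 / \<phi> (f z)) + a1 * Ln (\<phi> (f z) / \<phi> z) = g z"
    using big small eventually_neq_at_within[of 0 0 UNIV]
      Ln_quotient_small[OF tangent_comp_quotient[OF \<phi> f] \<beta>'']
  proof eventually_elim
    case (elim z)
    show ?case
    proof
      assume "\<bar>Arg (z * cis (- \<theta>))\<bar> < \<beta>"
      then have z: "z \<in> sector \<theta> \<beta> r" using elim by (simp add: sector_def)
      note fz = form[OF z]
      define w where "w = inv_into ?S ?h (?h (\<phi> z) + g z)"
      have w: "w \<in> ?S" "?h w = ?h (\<phi> z) + g z" "f z = \<psi> w"
        using fz inv_into_into f_inv_into_f unfolding w_def by metis+
      have "norm w < \<delta>"
      proof (rule ccontr)
        assume "\<not> norm w < \<delta>"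
        then have "norm (?h w) \<le> B"
          unfolding B_def using w(1) \<delta>(1) by (intro h_branch_bounded) (auto simp: sector_def)
        with elim(1) w(2) show False by simp
      qed
      then have \<phi>f: "\<phi> (f z) = w" using \<delta>(2) w(3) by simp
      have "\<phi> z \<noteq> 0" "\<bar>Arg (\<phi> z * cis (- \<theta>))\<bar> < \<beta>'"
        using fz by (auto simp: sector_def)
      then have "log_branch \<theta> (\<phi> z * (\<phi> (f z) / \<phi> z)) = log_branch \<theta> (\<phi> z) + Ln (\<phi> (f z) / \<phi> z)"
        using elim by (intro log_branch_mult(1)) auto
      then have L: "log_branch \<theta> (\<phi> (f z)) = log_branch \<theta> (\<phi> z) + Ln (\<phi> (f z) / \<phi> z)"
        using \<open>\<phi> z \<noteq> 0\<close> by simp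
      have "g z = ?h (\<phi> (f z)) - ?h (\<phi> z)" using w(2) \<phi>f by simp
      also have "\<dots> = a0 * (1 / \<phi> z - 1 / \<phi> (f z)) + a1 * Ln (\<phi> (f z) / \<phi> z)"
        unfolding h_branch_def L by (simp add: algebra_simps)
      finally show "a0 * (1 / \<phi> z - 1 / \<phi> (f z)) + a1 * Ln (\<phi> (f z) / \<phi> z) = g z" by simp
    qed
  qed
  with \<beta>(1) show thesis by (rule that)
qed

text \<open>The equation on the right no longer depends on a direction, so its validity on the
  sectors in the directions 0 and \<open>pi\<close>, which cover a punctured disc, is its validity
  near 0. Conversely it yields the sectorial form in every direction.\<close>

lemma has_normal_form_iff_conjugates:
  assumes l: "l \<le> 1" and a: "\<alpha> 0 \<noteq> 0 \<or> \<alpha> 1 \<noteq> 0" and f: "tangent_to_identity f" and g: "g analytic_on {0}"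
  shows "has_normal_form l \<alpha> f g \<phi> \<longleftrightarrow>
           tangent_to_identity \<phi> \<and> conjugates_to_translation (\<alpha> 0) (\<alpha> 1) \<phi> f g"
proof
  assume nf: "has_normal_form l \<alpha> f g \<phi>"
  then obtain \<psi> where \<phi>: "tangent_to_identity \<phi>" and \<psi>: "germ_inverse \<phi> \<psi>"
    and form: "sectorial_form 0 (\<alpha> 0) (\<alpha> 1) f g \<phi> \<psi>" "sectorial_form pi (\<alpha> 0) (\<alpha> 1) f g \<phi> \<psi>"
    using l unfolding has_normal_form_def by auto
  let ?P = "\<lambda>z. \<alpha> 0 * (1 / \<phi> z - 1 / \<phi> (f z)) + \<alpha> 1 * Ln (\<phi> (f z) / \<phi> z) = g z"
  obtain \<beta>1 where \<beta>1: "pi / 2 < \<beta>1" "\<forall>\<^sub>F z in at 0. \<bar>Arg (z * cis (- 0))\<bar> < \<beta>1 \<longrightarrow> ?P z"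
    by (rule sectorial_form_imp_conjugates_on_sector[OF a f \<phi> g \<psi> form(1)])
  obtain \<beta>2 where \<beta>2: "pi / 2 < \<beta>2" "\<forall>\<^sub>F z in at 0. \<bar>Arg (z * cis (- pi))\<bar> < \<beta>2 \<longrightarrow> ?P z"
    by (rule sectorial_form_imp_conjugates_on_sector[OF a f \<phi> g \<psi> form(2)])
  have "\<forall>\<^sub>F z in at 0. ?P z"
    using \<beta>1(2) \<beta>2(2) eventually_neq_at_within[of 0 0 UNIV]
    by eventually_elim (use sector_cover[OF _ \<beta>1(1) \<beta>2(1)] in blast)
  with \<phi> show "tangent_to_identity \<phi> \<and> conjugates_to_translation (\<alpha> 0) (\<alpha> 1) \<phi> f g"
    by (simp add: conjugates_to_translation_def)
next
  assume \<phi>: "tangent_to_identity \<phi> \<and> conjugates_to_translation (\<alpha> 0) (\<alpha> 1) \<phi> f g"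
  then obtain \<psi> where \<psi>: "germ_inverse \<phi> \<psi>" using tangent_germ_inverse by blast
  with \<phi> show "has_normal_form l \<alpha> f g \<phi>"
    using l conjugates_imp_sectorial_form[OF a f _ \<psi>] unfolding has_normal_form_def by auto
qed

text \<open>The factor \<open>\<phi> z / z\<close> turns by less than \<open>pi / 3\<close>, the gap
  between the half-opening \<open>2 * pi / 3\<close> and the cut. The constant \<open>c\<close> is
  fixed before \<open>\<theta>\<close>, as \<open>solution_given_by\<close> demands.\<close>

lemma analytic_part_imp_solution_branch:
  assumes \<phi>: "tangent_to_identity \<phi>" and P: "\<forall>\<^sub>F z in at 0. R z = analytic_part a0 a1 \<phi> z + c"
  shows "\<exists>\<beta> r. pi / 2 < \<beta> \<and> \<beta> < pi \<and> 0 < r \<and>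
           (\<forall>z\<in>sector \<theta> \<beta> r. solution_branch \<theta> a0 a1 R z = h_branch \<theta> a0 a1 (\<phi> z) + c)"
proof -
  have pi3: "0 < pi / 3" by simp
  have "\<forall>\<^sub>F z in at 0. R z = analytic_part a0 a1 \<phi> z + c \<and> \<phi> z / z \<noteq> 0 \<and> \<bar>Im (Ln (\<phi> z / z))\<bar> < pi / 3"
    using P Ln_quotient_small[OF tangent_quotient[OF \<phi>] pi3] by eventually_elim auto
  then obtain r where r: "0 < r" and near: "\<And>z. z \<noteq> 0 \<Longrightarrow> norm z < r \<Longrightarrow>
      R z = analytic_part a0 a1 \<phi> z + c \<and> \<phi> z / z \<noteq> 0 \<and> \<bar>Im (Ln (\<phi> z / z))\<bar> < pi / 3"
    unfolding eventually_at by (auto simp: dist_norm)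
  have "solution_branch \<theta> a0 a1 R z = h_branch \<theta> a0 a1 (\<phi> z) + c" if "z \<in> sector \<theta> (2 * pi / 3) r" for z
  proof -
    have z: "z \<noteq> 0" "norm z < r" "\<bar>Arg (z * cis (- \<theta>))\<bar> < 2 * pi / 3"
      using that by (auto simp: sector_def)
    note n = near[OF z(1,2)]
    have "log_branch \<theta> (z * (\<phi> z / z)) = log_branch \<theta> z + Ln (\<phi> z / z)"
      by (rule log_branch_mult(1)[OF _ _ z(3)]) (use z n in auto)
    then have L: "log_branch \<theta> (\<phi> z) = log_branch \<theta> z + Ln (\<phi> z / z)"
      using z by simp
    have "R z = analytic_part a0 a1 \<phi> z + c" using n by simp
    then show ?thesis
      unfolding solution_branch_def h_branch_def L analytic_part_def by (simp add: algebra_simps)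
  qed
  then show ?thesis using r by (intro exI[of _ "2 * pi / 3"] exI[of _ r]) auto
qed

section \<open>The power normal form\<close>

lemma powr_inverse_nat_power:
  fixes w :: complex
  assumes "w \<noteq> 0" "0 < n"
  shows "(w powr (1 / of_nat n)) ^ n = w"
  using assms by (simp add: powr_def flip: exp_of_nat_mult)

text \<open>The bound on the argument makes \<open>n * Ln t\<close> the principal logarithm of
  \<open>t ^ n\<close>, so the principal root is \<open>t\<close> itself and not its product with
  another root of unity.\<close>

lemma power_powr_inverse_nat:
  fixes t :: complex
  assumes "t \<noteq> 0" "0 < n" "\<bar>Im (Ln t)\<bar> < pi / of_nat n"
  shows "(t ^ n) powr (1 / of_nat n) = t"
proof -
  have "\<bar>Im (of_nat n * Ln t)\<bar> < pi"
    using assms by (simp add: abs_mult field_simps)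
  then have "Ln (exp (of_nat n * Ln t)) = of_nat n * Ln t"
    by (intro Ln_exp) auto
  moreover have "exp (of_nat n * Ln t) = t ^ n"
    using assms by (simp add: exp_of_nat_mult)
  ultimately have "Ln (t ^ n) = of_nat n * Ln t" by simp
  then show ?thesis using assms by (simp add: powr_def)
qed

text \<open>The base \<open>w\<close> of the power tends to 1 because \<open>g\<close> has order
  \<open>n + 1\<close> and \<open>\<phi> ^ n\<close> only order \<open>n\<close>. The power equation
  says \<open>\<phi> (f z) ^ n = \<phi> z ^ n * w z\<close>. It follows from the root form by taking
  powers; conversely \<open>\<phi> (f z) / \<phi> z\<close> tends to 1 and so is the principal root
  of \<open>w z\<close>.\<close>

lemma root_form_iff_power_form:
  assumes f: "tangent_to_identity f" and \<phi>: "tangent_to_identity \<phi>" and n: "0 < n" and a: "a \<noteq> 0"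
    and g: "((\<lambda>z. g z / z ^ Suc n) \<longlongrightarrow> a) (at 0)"
  shows "(\<exists>\<psi>. germ_inverse \<phi> \<psi> \<and> (\<forall>\<^sub>F z in nhds 0.
            f z = \<psi> (\<phi> z * (1 + of_nat n / a * (g z / \<phi> z ^ n)) powr (1 / of_nat n)))) \<longleftrightarrow>
         (\<forall>\<^sub>F z in at 0. a / of_nat n * (\<phi> (f z) ^ n - \<phi> z ^ n) = g z)" (is "(\<exists>\<psi>. _ \<and> ?F \<psi>) \<longleftrightarrow> ?rhs")
proof -
  define w where "w z = 1 + of_nat n / a * (g z / \<phi> z ^ n)" for z
  have f0: "f 0 = 0" and \<phi>0: "\<phi> 0 = 0" and \<phi>an: "\<phi> analytic_on {0}"
    using f \<phi> by (auto simp: tangent_to_identity_def)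
  have "((\<lambda>z. 1 + of_nat n / a * (g z / z ^ Suc n * z / (\<phi> z / z) ^ n)) \<longlongrightarrow>
          1 + of_nat n / a * (a * 0 / 1 ^ n)) (at 0)"
    by (intro tendsto_intros g tangent_quotient \<phi>) auto
  moreover have "\<forall>\<^sub>F z in at 0. 1 + of_nat n / a * (g z / z ^ Suc n * z / (\<phi> z / z) ^ n) = w z"
    using eventually_neq_at_within[of 0 0 UNIV]
    by eventually_elim (simp add: w_def power_divide)
  ultimately have "(w \<longlongrightarrow> 1 + of_nat n / a * (a * 0 / 1 ^ n)) (at 0)"
    by (rule Lim_transform_eventually)
  then have w: "(w \<longlongrightarrow> 1) (at 0)" by simp
  have power_iff: "a / of_nat n * (x ^ n - \<phi> z ^ n) = g z \<longleftrightarrow> x ^ n = \<phi> z ^ n * w z" if "\<phi> z \<noteq> 0" for x z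
  proof -
    have "\<phi> z ^ n * w z = \<phi> z ^ n + of_nat n / a * g z"
      using that by (simp add: w_def distrib_left)
    moreover have "a / of_nat n * (x ^ n - \<phi> z ^ n) = g z \<longleftrightarrow> x ^ n = \<phi> z ^ n + of_nat n / a * g z"
      using a n by (auto simp: field_simps)
    ultimately show ?thesis by simp
  qed
  show ?thesis
  proof
    assume "\<exists>\<psi>. germ_inverse \<phi> \<psi> \<and> ?F \<psi>"
    then obtain \<psi> where \<psi>: "germ_inverse \<phi> \<psi>"
      and F: "\<forall>\<^sub>F z in nhds 0. f z = \<psi> (\<phi> z * w z powr (1 / of_nat n))"
      unfolding w_def by blast
    \<comment> \<open>The argument of \<open>\<psi>\<close> has to tend to 0 for
      \<open>\<phi> \<circ> \<psi> = id\<close> to be available there.\<close>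
    have "((\<lambda>z. \<phi> z * w z powr (1 / of_nat n)) \<longlongrightarrow> \<phi> 0 * 1 powr (1 / of_nat n)) (at 0)"
      by (intro tendsto_intros analytic_0_tendsto \<phi>an tendsto_powr_complex w) auto
    then have X: "filterlim (\<lambda>z. \<phi> z * w z powr (1 / of_nat n)) (nhds 0) (at 0)"
      using \<phi>0 by simp
    have "\<forall>\<^sub>F x in nhds 0. \<phi> (\<psi> x) = x"
      using \<psi> unfolding germ_inverse_def by (auto elim: eventually_mono)
    from eventually_compose_filterlim[OF this X] tangent_nonzero[OF \<phi>]
      tendsto_imp_eventually_ne[OF w, of 0, simplified] filter_leD[OF at_within_le_nhds F]
    show ?rhs
    proof eventually_elim
      case (elim z)
      have "\<phi> (f z) ^ n = \<phi> z ^ n * w z"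
        using elim powr_inverse_nat_power[OF elim(3) n] by (simp add: power_mult_distrib)
      then show ?case using power_iff elim(2) by blast
    qed
  next
    assume rhs: ?rhs
    obtain \<psi> where \<psi>: "germ_inverse \<phi> \<psi>" by (rule tangent_germ_inverse[OF \<phi>])
    then have "\<forall>\<^sub>F z in nhds 0. \<psi> (\<phi> z) = z"
      unfolding germ_inverse_def by (auto elim: eventually_mono)
    note inv = eventually_compose_filterlim[OF filter_leD[OF at_within_le_nhds this] tangent_filterlim[OF f]]
    have pin: "0 < pi / of_nat n" using n by simp
    have "\<forall>\<^sub>F z in at 0. f z = \<psi> (\<phi> z * w z powr (1 / of_nat n))"
      using rhs inv tangent_nonzero[OF \<phi>] Ln_quotient_small[OF tangent_comp_quotient[OF \<phi> f] pin]
    proof eventually_elim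
      case (elim z)
      then have "\<phi> (f z) ^ n = \<phi> z ^ n * w z" using power_iff by blast
      then have "w z = (\<phi> (f z) / \<phi> z) ^ n"
        using elim by (simp add: power_divide field_simps)
      then have "w z powr (1 / of_nat n) = \<phi> (f z) / \<phi> z"
        using power_powr_inverse_nat[of "\<phi> (f z) / \<phi> z" n] elim n by simp
      then show ?case using elim by simp
    qed
    \<comment> \<open>At 0 the quotient inside \<open>w\<close> is a division by zero, but the
      factor \<open>\<phi> 0 = 0\<close> cancels whatever value it takes.\<close>
    moreover have "f 0 = \<psi> (\<phi> 0 * w 0 powr (1 / of_nat n))"
      using f0 \<phi>0 \<psi> by (simp add: germ_inverse_def)
    ultimately have "?F \<psi>"
      unfolding w_def by (subst eventually_nhds_conv_at) blast
    with \<psi> show "\<exists>\<psi>. germ_inverse \<phi> \<psi> \<and> ?F \<psi>" by blast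
  qed
qed

text \<open>If \<open>R - R 0\<close> is \<open>z ^ m * E z\<close>, the equation gives
  \<open>g\<close> the order \<open>m + 1\<close> and the leading coefficient
  \<open>m * E 0\<close>. Comparing with \<open>g\<close> yields \<open>m = n\<close> and
  \<open>E 0 = a / n\<close>, and \<open>\<phi>\<close> is \<open>z\<close> times an
  \<open>n\<close>-th root of \<open>E z / E 0\<close>.\<close>

lemma solution_imp_power:
  assumes f: "tangent_to_identity f" and f2: "((\<lambda>z. (f z - z) / z ^ 2) \<longlongrightarrow> 1) (at 0)"
    and n: "0 < n" and a: "a \<noteq> 0" and g: "((\<lambda>z. g z / z ^ Suc n) \<longlongrightarrow> a) (at 0)"
    and R: "R analytic_on {0}" and eq: "\<forall>\<^sub>F z in at 0. R (f z) - R z = g z"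
  obtains \<phi> where "tangent_to_identity \<phi>" "\<forall>\<^sub>F z in nhds 0. R z = a / of_nat n * \<phi> z ^ n + R 0"
proof -
  have gnz: "\<forall>\<^sub>F z in at 0. g z \<noteq> 0"
    using tendsto_imp_eventually_ne[OF g a] by (auto elim!: eventually_mono)
  let ?A = "\<lambda>z. R z - R 0"
  have "\<not> (\<forall>\<^sub>F z in nhds 0. ?A z = 0)"
  proof
    assume A: "\<forall>\<^sub>F z in nhds 0. ?A z = 0"
    have "\<forall>\<^sub>F z in at (0::complex). False"
      using filter_leD[OF at_within_le_nhds A] eq gnz
        eventually_compose_filterlim[OF filter_leD[OF at_within_le_nhds A] tangent_filterlim[OF f]]
      by eventually_elim auto
    then show False by simp
  qed
  moreover have "?A analytic_on {0}" using R by (auto intro!: analytic_intros)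
  ultimately obtain m E where m: "0 < m" and E: "E analytic_on {0}" "E 0 \<noteq> 0"
      and AE: "\<forall>\<^sub>F z in nhds 0. ?A z = z ^ m * E z"
    using analytic_0_factor_power[of ?A] by auto
  have "((\<lambda>z. (?A (f z) - ?A z) / z ^ Suc m) \<longlongrightarrow> of_nat m * E 0) (at 0)"
    by (rule power_difference_quotient[OF f f2 E(1) AE])
  moreover have "\<forall>\<^sub>F z in at 0. (?A (f z) - ?A z) / z ^ Suc m = g z / z ^ Suc m"
    using eq by eventually_elim simp
  ultimately have gm: "((\<lambda>z. g z / z ^ Suc m) \<longlongrightarrow> of_nat m * E 0) (at 0)"
    by (rule Lim_transform_eventually)
  \<comment> \<open>The order of \<open>g\<close> is determined: a nonzero limit at one order
    excludes any limit at a higher one.\<close>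
  have less_False: False
    if "((\<lambda>z. g z / z ^ Suc i) \<longlongrightarrow> x) (at 0)" "x \<noteq> 0" "((\<lambda>z. g z / z ^ Suc j) \<longlongrightarrow> y) (at 0)" "i < j" for i j x y
    using tendsto_unique[OF at_neq_bot that(1) tendsto_divide_lower_power[OF that(3)]] that(2,4) by simp
  have "of_nat m * E 0 \<noteq> 0" using m E by simp
  then have mn: "m = n"
    using less_False[OF g a gm] less_False[OF gm _ g] by (meson linorder_neqE_nat)
  have "of_nat n * E 0 = a"
    using gm g unfolding mn by (rule tendsto_unique[OF at_neq_bot])
  then have c: "a / of_nat n = E 0" using n by (simp add: field_simps)
  \<comment> \<open>The principal root is analytic at 0 and equals 1 there, since
    \<open>E z / E 0\<close> is 1 at 0.\<close>
  define u where "u z = exp (Ln (E z / E 0) / of_nat n)" for z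
  show thesis
  proof (rule that)
    show "tangent_to_identity (\<lambda>z. z * u z)"
      using E n by (intro tangent_mult) (auto simp: u_def intro!: analytic_intros)
    have "\<forall>\<^sub>F z in nhds 0. E z \<noteq> 0"
      using analytic_at_imp_isCont[OF E(1)] E(2) unfolding isCont_def tendsto_at_iff_tendsto_nhds
      by (rule tendsto_imp_eventually_ne)
    then show "\<forall>\<^sub>F z in nhds 0. R z = a / of_nat n * (z * u z) ^ n + R 0"
      using AE
    proof eventually_elim
      case (elim z)
      have "u z ^ n = exp (Ln (E z / E 0))"
        unfolding u_def using n by (simp flip: exp_of_nat_mult)
      also have "\<dots> = E z / E 0" using elim E by simp
      finally have "a / of_nat n * (z * u z) ^ n = z ^ m * E z"
        using E unfolding c power_mult_distrib by (simp add: mn)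
      with elim show ?case by (simp add: algebra_simps)
    qed
  qed
qed

section \<open>The cohomological equation\<close>

theorem theorem2:
  fixes f g :: "complex \<Rightarrow> complex" and \<alpha> :: "nat \<Rightarrow> complex" and l :: nat
  assumes "prenormalized_germ f"
    and "formally_equivalent f (\<lambda>z. z / (1 - z))"
    and "g has_fps_expansion Abs_fps \<alpha>"
    and "\<not> (\<forall>\<^sub>F z in nhds 0. g z = 0)"
    and "(\<lambda>z. g z - \<alpha> l * z ^ l) \<in> o[at 0](\<lambda>z. z ^ l)"
    and "\<alpha> l \<noteq> 0"
  shows "((\<exists>R. globally_analytic_solution (\<alpha> 0) (\<alpha> 1) f g R) \<longleftrightarrow>
            (\<exists>\<phi>. has_normal_form l \<alpha> f g \<phi>)) \<and>
         (\<forall>R1 R2. globally_analytic_solution (\<alpha> 0) (\<alpha> 1) f g R1 \<and>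
            globally_analytic_solution (\<alpha> 0) (\<alpha> 1) f g R2 \<longrightarrow>
            (\<exists>c. \<forall>\<^sub>F z in nhds 0. R1 z = R2 z + c)) \<and>
         (\<forall>\<phi> R. has_normal_form l \<alpha> f g \<phi> \<and>
            globally_analytic_solution (\<alpha> 0) (\<alpha> 1) f g R \<longrightarrow>
            solution_given_by l \<alpha> \<phi> R)"
proof -
  note f = prenormalized_germ_tangent[OF assms(1)]
  have g: "g analytic_on {0}" using assms(3) has_fps_expansion_imp_analytic_0 by blast
  let ?sol = "globally_analytic_solution (\<alpha> 0) (\<alpha> 1) f g"
  have unique: "\<exists>c. \<forall>\<^sub>F z in nhds 0. R1 z = R2 z + c" if "?sol R1" "?sol R2" for R1 R2
  proof -
    have "\<forall>\<^sub>F z in nhds 0. R1 z - R2 z = R1 0 - R2 0"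
    proof (rule invariant_imp_const[OF f])
      show "(\<lambda>z. R1 z - R2 z) analytic_on {0}"
        using that by (auto simp: globally_analytic_solution_def intro!: analytic_intros)
      have "\<forall>\<^sub>F z in at 0. R1 (f z) - R1 z = R2 (f z) - R2 z"
        using that[unfolded globally_analytic_solution_def, THEN conjunct2] by eventually_elim simp
      then show "\<forall>\<^sub>F z in at 0. R1 (f z) - R2 (f z) = R1 z - R2 z"
        by eventually_elim (simp add: algebra_simps)
    qed
    then have "\<forall>\<^sub>F z in nhds 0. R1 z = R2 z + (R1 0 - R2 0)"
      by eventually_elim (simp add: algebra_simps)
    then show ?thesis by blast
  qed
  have "((\<exists>R. ?sol R) \<longleftrightarrow> (\<exists>\<phi>. has_normal_form l \<alpha> f g \<phi>)) \<and>
        (\<forall>\<phi> R. has_normal_form l \<alpha> f g \<phi> \<and> ?sol R \<longrightarrow> solution_given_by l \<alpha> \<phi> R)"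
  proof (cases "l \<le> 1")
    case True
    then have a: "\<alpha> 0 \<noteq> 0 \<or> \<alpha> 1 \<noteq> 0" using assms(6) by (cases l) auto
    note nf = has_normal_form_iff_conjugates[OF True a f(1) g]
    have sol: "\<exists>R. ?sol R \<and> (\<forall>\<^sub>F z in at 0. R z = analytic_part (\<alpha> 0) (\<alpha> 1) \<phi> z)"
      if "has_normal_form l \<alpha> f g \<phi>" for \<phi>
    proof -
      have \<phi>: "tangent_to_identity \<phi>" "conjugates_to_translation (\<alpha> 0) (\<alpha> 1) \<phi> f g"
        using that nf by auto
      obtain R where R: "R analytic_on {0}" "\<forall>\<^sub>F z in at 0. R z = analytic_part (\<alpha> 0) (\<alpha> 1) \<phi> z"
        by (rule analytic_part_extends[OF \<phi>(1)])
      then show ?thesis using solution_iff_conjugates[OF f(1) \<phi>(1) R(1), of _ _ 0] \<phi>(2) by auto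
    qed
    have "\<exists>\<phi>. has_normal_form l \<alpha> f g \<phi>" if R: "?sol R" for R
    proof -
      have an: "R analytic_on {0}" using R by (simp add: globally_analytic_solution_def)
      obtain \<phi> c where \<phi>: "tangent_to_identity \<phi>" "\<forall>\<^sub>F z in at 0. R z + c = analytic_part (\<alpha> 0) (\<alpha> 1) \<phi> z"
        by (rule analytic_part_surj[OF an a])
      from \<phi>(2) have "\<forall>\<^sub>F z in at 0. R z = analytic_part (\<alpha> 0) (\<alpha> 1) \<phi> z + (- c)"
        by eventually_elim (simp add: algebra_simps)
      then show ?thesis using solution_iff_conjugates[OF f(1) \<phi>(1) an] nf \<phi>(1) R by blast
    qed
    moreover have "solution_given_by l \<alpha> \<phi> R" if \<phi>: "has_normal_form l \<alpha> f g \<phi>" and R: "?sol R" for \<phi> R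
    proof -
      \<comment> \<open>The formula is known for the solution built from \<open>\<phi>\<close>;
        uniqueness carries it over to \<open>R\<close> with one constant for both sectors.\<close>
      obtain R' where R': "?sol R'" "\<forall>\<^sub>F z in at 0. R' z = analytic_part (\<alpha> 0) (\<alpha> 1) \<phi> z"
        using sol[OF \<phi>] by blast
      obtain c where "\<forall>\<^sub>F z in nhds 0. R z = R' z + c"
        using unique[OF R R'(1)] by blast
      from filter_leD[OF at_within_le_nhds this] R'(2)
      have "\<forall>\<^sub>F z in at 0. R z = analytic_part (\<alpha> 0) (\<alpha> 1) \<phi> z + c"
        by eventually_elim simp
      from analytic_part_imp_solution_branch[OF _ this] show ?thesis
        unfolding solution_given_by_def if_P[OF True] using \<phi>[unfolded nf] by blast
    qed
    ultimately show ?thesis using sol by blast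
  next
    case False
    define n where "n = l - 1"
    have n: "0 < n" "l = Suc n" "l - 1 = n" using False by (auto simp: n_def)
    have "((\<lambda>z. (g z - \<alpha> l * z ^ l) / z ^ l + \<alpha> l) \<longlongrightarrow> 0 + \<alpha> l) (at 0)"
      by (intro tendsto_intros smalloD_tendsto[OF assms(5)])
    moreover have "\<forall>\<^sub>F z in at 0. (g z - \<alpha> l * z ^ l) / z ^ l + \<alpha> l = g z / z ^ l"
      using eventually_neq_at_within[of 0 0 UNIV] by eventually_elim (simp add: field_simps)
    ultimately have "((\<lambda>z. g z / z ^ l) \<longlongrightarrow> 0 + \<alpha> l) (at 0)"
      by (rule Lim_transform_eventually)
    then have gl: "((\<lambda>z. g z / z ^ Suc n) \<longlongrightarrow> \<alpha> l) (at 0)" by (simp add: n)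
    \<comment> \<open>The cases \<open>i = 0\<close> and \<open>i = 1\<close> give
      \<open>\<alpha> 0 = \<alpha> 1 = 0\<close>. The singular terms then disappear and the equation
      for \<open>R\<close> is \<open>R \<circ> f - R = g\<close>.\<close>
    have glow: "((\<lambda>z. g z / z ^ i) \<longlongrightarrow> 0) (at 0)" if "i < l" for i
      using tendsto_divide_lower_power[OF gl] that n by simp
    have g0: "g 0 = 0"
      using tendsto_unique[OF at_neq_bot analytic_0_tendsto[OF g]] glow[of 0] n by simp
    then have a0: "\<alpha> 0 = 0" using has_fps_expansion_imp_0_eq_fps_nth_0[OF assms(3)] by simp
    have "(g has_field_derivative 0) (at 0)"
      using glow[of 1] n g0 by (simp add: has_field_derivative_iff)
    then have a1: "\<alpha> 1 = 0"
      using DERIV_imp_deriv fps_nth_fps_expansion[OF assms(3), of 1] by fastforce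
    have sol: "?sol R \<longleftrightarrow> R analytic_on {0} \<and> (\<forall>\<^sub>F z in at 0. R (f z) - R z = g z)" for R
      by (simp add: globally_analytic_solution_def a0 a1[unfolded One_nat_def])
    have nf: "has_normal_form l \<alpha> f g \<phi> \<longleftrightarrow> tangent_to_identity \<phi> \<and>
        (\<forall>\<^sub>F z in at 0. \<alpha> l / of_nat n * (\<phi> (f z) ^ n - \<phi> z ^ n) = g z)" for \<phi>
      unfolding has_normal_form_def n(3) using False root_form_iff_power_form[OF f(1) _ n(1) assms(6) gl, of \<phi>]
      by auto
    have power_sol: "?sol (\<lambda>z. \<alpha> l / of_nat n * \<phi> z ^ n)" if "has_normal_form l \<alpha> f g \<phi>" for \<phi>
      using that n(1) unfolding nf sol right_diff_distrib
      by (auto simp: tangent_to_identity_def intro!: analytic_intros)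
    have "\<exists>\<phi>. has_normal_form l \<alpha> f g \<phi>" if R: "?sol R" for R
    proof -
      have R: "R analytic_on {0}" "\<forall>\<^sub>F z in at 0. R (f z) - R z = g z" using R sol by auto
      obtain \<phi> where \<phi>: "tangent_to_identity \<phi>" "\<forall>\<^sub>F z in nhds 0. R z = \<alpha> l / of_nat n * \<phi> z ^ n + R 0"
        by (rule solution_imp_power[OF f n(1) assms(6) gl R])
      note ev = filter_leD[OF at_within_le_nhds \<phi>(2)]
      have "\<forall>\<^sub>F z in at 0. \<alpha> l / of_nat n * (\<phi> (f z) ^ n - \<phi> z ^ n) = g z"
        using R(2) ev eventually_compose_filterlim[OF ev tangent_filterlim[OF f(1)]]
      proof eventually_elim
        case (elim z)
        have "\<alpha> l / of_nat n * (\<phi> (f z) ^ n - \<phi> z ^ n) = R (f z) - R z"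
          unfolding elim(2,3) by (simp only: algebra_simps)
        with elim(1) show ?case by simp
      qed
      with \<phi>(1) show ?thesis using nf by blast
    qed
    moreover have "solution_given_by l \<alpha> \<phi> R" if "has_normal_form l \<alpha> f g \<phi>" "?sol R" for \<phi> R
      unfolding solution_given_by_def n(3) using False unique[OF that(2) power_sol[OF that(1)]] by auto
    ultimately show ?thesis using power_sol by blast
  qed
  with unique show ?thesis by blast
qed

end
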